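(* Let $\lambda$ be a partition and let $j,k$ be non-negative integers with ($k=0$ or $k\ge \lambda_2$) and ($j=0$ or $j\ge \lambda'_2$). For $m\ge 0$ let $\lambda^{(m)} = \lambda\cup(1^{mj}) + (mk)$. Then the sequence of Schur functions \[ s_{\lambda^{(0)}},\ s_{\lambda^{(1)}},\ s_{\lambda^{(2)}},\ s_{\lambda^{(3)}},\ \ldots \] is strongly Schur log-concave, i.e. $s_{\lambda^{(n+i)}}s_{\lambda^{(n)}} - s_{\lambda^{(n+i+1)}}s_{\lambda^{(n-1)}}$ is Schur positive for all $n\ge1$ and $i\ge0$.
   Context: Work in the algebra $\Lambda$ of symmetric functions (in infinitely many variables) with its basis of Schur functions $s_\mu$. An element is Schur positive if all coefficients in its expansion in the Schur basis are non-negative. $\lambda'$ denotes the transpose (conjugate) partition, so $\lambda'_2$ is the length of the second column of the Young diagram of $\lambda$. For partitions $\lambda,\mu$, $\lambda\cup\mu$ is the partition obtained by sorting all parts of $\lambda$ and $\mu$ together in weakly decreasing order; $(1^{r})$ is the partition with $r$ parts equal to $1$; and $\lambda+(r)$ denotes the partition obtained by adding $r$ to the first part of $\lambda$. *)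

theory Defs
  imports "HOL-Library.FuncSet" "HOL-Library.Poly_Mapping"
begin

section \<open>Partitions\<close>

text \<open>A partition is the weakly decreasing list of its (positive) parts.\<close>

definition is_partition :: "nat list \<Rightarrow> bool" where
  "is_partition lam \<longleftrightarrow> sorted_wrt (\<ge>) lam \<and> 0 \<notin> set lam"

text \<open>\<open>part lam i\<close> is the part \<open>\<lambda>\<^sub>i\<close>: parts are numbered from \<open>1\<close> and vanish beyond the length.\<close>

definition part :: "nat list \<Rightarrow> nat \<Rightarrow> nat" where
  "part lam i = (if 1 \<le> i \<and> i \<le> length lam then lam ! (i - 1) else 0)"

definition transpose_partition :: "nat list \<Rightarrow> nat list" where
  "transpose_partition lam = map (\<lambda>c. length (filter (\<lambda>p. c \<le> p) lam)) [1..<Suc (part lam 1)]"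

definition union_partition :: "nat list \<Rightarrow> nat list \<Rightarrow> nat list" where
  "union_partition lam mu = rev (sort (lam @ mu))"

text \<open>The first part of the empty partition is \<open>0\<close>, so adding \<open>r\<close> to it gives \<open>(r)\<close>.\<close>

fun add_first :: "nat list \<Rightarrow> nat \<Rightarrow> nat list" where
  "add_first [] r = (if r = 0 then [] else [r])"
| "add_first (p # ps) r = (p + r) # ps"

lemma is_partition_union_partition:
  "is_partition lam \<Longrightarrow> is_partition mu \<Longrightarrow> is_partition (union_partition lam mu)"
  by (auto simp: is_partition_def union_partition_def sorted_wrt_rev)

lemma is_partition_ones: "is_partition (replicate r 1)"
  by (induction r) (auto simp: is_partition_def)

lemma is_partition_add_first: "is_partition lam \<Longrightarrow> is_partition (add_first lam r)"
  by (cases lam) (auto simp: is_partition_def)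

lemma part_transpose_partition:
  assumes "is_partition lam" "1 \<le> c"
  shows "part (transpose_partition lam) c = card {r. 1 \<le> r \<and> c \<le> part lam r}"
proof -
  have "{r. 1 \<le> r \<and> c \<le> part lam r} = Suc ` {i. i < length lam \<and> c \<le> lam ! i}"
    using assms(2) by (auto simp: part_def image_iff gr0_conv_Suc Suc_le_eq split: if_splits)
  hence *: "card {r. 1 \<le> r \<and> c \<le> part lam r} = length (filter (\<lambda>p. c \<le> p) lam)"
    by (simp add: card_image length_filter_conv_card)
  have "filter (\<lambda>p. c \<le> p) lam = []" if "\<not> c \<le> part lam 1"
    using that assms by (cases lam) (auto simp: is_partition_def part_def filter_empty_conv)
  moreover have "part (map f [1..<Suc n]) c = (if c \<le> n then f c else 0)" for f n
    using assms(2) by (simp add: part_def del: upt_Suc)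
  ultimately show ?thesis
    unfolding * transpose_partition_def by auto
qed


section \<open>Power series in infinitely many variables\<close>

text \<open>
  Integral formal power series in variables \<open>x\<^sub>0, x\<^sub>1, x\<^sub>2, \<dots>\<close>; a monomial is given by its finitely
  supported exponent vector. The algebra \<open>\<Lambda>\<close> of symmetric functions is the subring of the
  symmetric series of bounded degree.
\<close>

typedef power_series = "UNIV :: ((nat \<Rightarrow>\<^sub>0 nat) \<Rightarrow> int) set"
  morphisms coeff_of power_series_of ..

lemma coeff_of_inject': "f = g \<longleftrightarrow> (\<forall>m. coeff_of f m = coeff_of g m)"
  by (simp flip: coeff_of_inject add: fun_eq_iff)

lemma coeff_of_power_series_of [simp]: "coeff_of (power_series_of f) = f"
  by (simp add: power_series_of_inverse)

lemma finite_pm_le: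
  fixes m :: "nat \<Rightarrow>\<^sub>0 nat"
  shows "finite {a :: nat \<Rightarrow>\<^sub>0 nat. \<forall>i. Poly_Mapping.lookup a i \<le> Poly_Mapping.lookup m i}"
proof -
  have "finite (Poly_Mapping.keys m \<rightarrow>\<^sub>E {..Max (insert 0 (range (Poly_Mapping.lookup m)))})"
    by (intro finite_PiE) auto
  moreover have "(\<lambda>a. restrict (Poly_Mapping.lookup a) (Poly_Mapping.keys m)) ` {a :: nat \<Rightarrow>\<^sub>0 nat. \<forall>i. Poly_Mapping.lookup a i \<le> Poly_Mapping.lookup m i}
    \<subseteq> (Poly_Mapping.keys m \<rightarrow>\<^sub>E {..Max (insert 0 (range (Poly_Mapping.lookup m)))})"
  proof -
    have "finite (range (Poly_Mapping.lookup m))"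
      by (rule finite_subset[of _ "insert 0 (Poly_Mapping.lookup m ` Poly_Mapping.keys m)"]) (auto simp: in_keys_iff)
    hence "Poly_Mapping.lookup m i \<le> Max (insert 0 (range (Poly_Mapping.lookup m)))" for i
      by (intro Max_ge) auto
    thus ?thesis by (fastforce intro: order_trans)
  qed
  ultimately have "finite ((\<lambda>a. restrict (Poly_Mapping.lookup a) (Poly_Mapping.keys m)) `
      {a :: nat \<Rightarrow>\<^sub>0 nat. \<forall>i. Poly_Mapping.lookup a i \<le> Poly_Mapping.lookup m i})"
    using finite_subset by blast
  moreover have "inj_on (\<lambda>a. restrict (Poly_Mapping.lookup a) (Poly_Mapping.keys m))
      {a :: nat \<Rightarrow>\<^sub>0 nat. \<forall>i. Poly_Mapping.lookup a i \<le> Poly_Mapping.lookup m i}"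
  proof (rule inj_onI, rule poly_mapping_eqI)
    fix a b :: "nat \<Rightarrow>\<^sub>0 nat" and i
    assume ab: "a \<in> {a. \<forall>i. Poly_Mapping.lookup a i \<le> Poly_Mapping.lookup m i}" "b \<in> {a. \<forall>i. Poly_Mapping.lookup a i \<le> Poly_Mapping.lookup m i}"
      and eq: "restrict (Poly_Mapping.lookup a) (Poly_Mapping.keys m) = restrict (Poly_Mapping.lookup b) (Poly_Mapping.keys m)"
    show "Poly_Mapping.lookup a i = Poly_Mapping.lookup b i"
    proof (cases "i \<in> Poly_Mapping.keys m")
      case True
      thus ?thesis using fun_cong[OF eq, of i] by simp
    next
      case False
      hence "Poly_Mapping.lookup m i = 0" by (simp add: in_keys_iff)
      thus ?thesis using ab by (metis (mono_tags, lifting) le_zero_eq mem_Collect_eq)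
    qed
  qed
  ultimately show ?thesis by (rule finite_imageD)
qed

lemma finite_splittings: "finite {(a, b). a + b = (m :: nat \<Rightarrow>\<^sub>0 nat)}"
proof (rule finite_subset)
  show "{(a, b). a + b = m} \<subseteq> {a. \<forall>i. Poly_Mapping.lookup a i \<le> Poly_Mapping.lookup m i} \<times> {a. \<forall>i. Poly_Mapping.lookup a i \<le> Poly_Mapping.lookup m i}"
    by (auto simp: lookup_add)
qed (intro finite_cartesian_product finite_pm_le)

instantiation power_series :: comm_ring_1
begin

definition "0 = power_series_of (\<lambda>m. 0)"
definition "1 = power_series_of (\<lambda>m. if m = 0 then 1 else 0)"
definition "f + g = power_series_of (\<lambda>m. coeff_of f m + coeff_of g m)"
definition "f - g = power_series_of (\<lambda>m. coeff_of f m - coeff_of g m)"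
definition "- f = power_series_of (\<lambda>m. - coeff_of f m)"
definition "f * g = power_series_of (\<lambda>m. \<Sum>(a, b)\<in>{(a, b). a + b = m}. coeff_of f a * coeff_of g b)"

instance
proof
  fix f g h :: power_series
  note defs = coeff_of_inject' zero_power_series_def one_power_series_def plus_power_series_def
    minus_power_series_def uminus_power_series_def times_power_series_def
  show "f + g + h = f + (g + h)" "f + g = g + f" "0 + f = f" "- f + f = 0" "f - g = f + - g"
    by (simp_all add: defs)
  show "(0 :: power_series) \<noteq> 1"
    by (auto simp: defs intro: exI[of _ 0])
  show "(f + g) * h = f * h + g * h"
    by (simp add: defs case_prod_unfold distrib_right sum.distrib)
  show "f * g = g * f"
    unfolding defs coeff_of_power_series_of
    by (intro allI sum.reindex_bij_witness[of _ prod.swap prod.swap]) (auto simp: add.commute)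
  show "1 * f = f"
  proof -
    have "(\<Sum>(a, b)\<in>{(a, b). a + b = m}. (if a = 0 then 1 else 0) * coeff_of f b) = coeff_of f m" for m
    proof -
      have "(\<Sum>(a, b)\<in>{(a, b). a + b = m}. (if a = 0 then 1 else 0) * coeff_of f b)
        = (\<Sum>(a, b)\<in>{(0 :: nat \<Rightarrow>\<^sub>0 nat, m)}. (if a = 0 then 1 else 0) * coeff_of f b)"
        by (rule sum.mono_neutral_right[OF finite_splittings]) (auto split: if_splits)
      thus ?thesis by simp
    qed
    thus ?thesis by (simp add: defs)
  qed
  show "f * g * h = f * (g * h)"
  proof -
    have "(\<Sum>(d, c)\<in>{(d, c). d + c = m}. (\<Sum>(a, b)\<in>{(a, b). a + b = d}. coeff_of f a * coeff_of g b) * coeff_of h c)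
      = (\<Sum>(a, d)\<in>{(a, d). a + d = m}. coeff_of f a * (\<Sum>(b, c)\<in>{(b, c). b + c = d}. coeff_of g b * coeff_of h c))"
      (is "?L = ?R") for m
    proof -
      have "?L = (\<Sum>x\<in>{(d, c). d + c = m}. \<Sum>y\<in>{(a, b). a + b = fst x}.
                coeff_of f (fst y) * coeff_of g (snd y) * coeff_of h (snd x))"
        by (simp add: case_prod_unfold sum_distrib_right)
      also have "\<dots> = (\<Sum>(x, y)\<in>Sigma {(d, c). d + c = m} (\<lambda>x. {(a, b). a + b = fst x}).
                coeff_of f (fst y) * coeff_of g (snd y) * coeff_of h (snd x))"
        by (rule sum.Sigma) (auto intro: finite_splittings)
      also have "\<dots> = (\<Sum>(x, y)\<in>Sigma {(a, d). a + d = m} (\<lambda>x. {(b, c). b + c = snd x}).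
                coeff_of f (fst x) * (coeff_of g (fst y) * coeff_of h (snd y)))"
        by (rule sum.reindex_bij_witness[of _
              "\<lambda>((a, d), (b, c)). ((a + b, c), (a, b))" "\<lambda>((d, c), (a, b)). ((a, b + c), (b, c))"])
          (auto simp: add.assoc mult.assoc)
      also have "\<dots> = (\<Sum>x\<in>{(a, d). a + d = m}. \<Sum>y\<in>{(b, c). b + c = snd x}.
                coeff_of f (fst x) * (coeff_of g (fst y) * coeff_of h (snd y)))"
        by (rule sum.Sigma[symmetric]) (auto intro: finite_splittings)
      also have "\<dots> = ?R"
        by (simp add: case_prod_unfold sum_distrib_left)
      finally show ?thesis .
    qed
    thus ?thesis by (simp add: defs)
  qed
qed

end


section \<open>Schur functions\<close>

text \<open>Boxes are indexed from \<open>0\<close> as (row, column), in English notation.\<close>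

definition young_diagram :: "nat list \<Rightarrow> (nat \<times> nat) set" where
  "young_diagram lam = {(r, c). r < length lam \<and> c < lam ! r}"

definition ssyt :: "nat list \<Rightarrow> (nat \<times> nat \<Rightarrow> nat) set" where
  "ssyt lam = {T \<in> young_diagram lam \<rightarrow>\<^sub>E UNIV.
     (\<forall>r c c'. c < c' \<longrightarrow> (r, c) \<in> young_diagram lam \<longrightarrow> (r, c') \<in> young_diagram lam \<longrightarrow>
        T (r, c) \<le> T (r, c')) \<and>
     (\<forall>r r' c. r < r' \<longrightarrow> (r, c) \<in> young_diagram lam \<longrightarrow> (r', c) \<in> young_diagram lam \<longrightarrow>
        T (r, c) < T (r', c))}"

definition content :: "nat list \<Rightarrow> (nat \<times> nat \<Rightarrow> nat) \<Rightarrow> (nat \<Rightarrow>\<^sub>0 nat)" where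
  "content lam T = (\<Sum>b\<in>young_diagram lam. Poly_Mapping.single (T b) 1)"

definition schur :: "nat list \<Rightarrow> power_series" where
  "schur lam = power_series_of (\<lambda>m. int (card {T \<in> ssyt lam. content lam T = m}))"

lemma finite_young_diagram: "finite (young_diagram lam)"
proof -
  have "young_diagram lam = Sigma {..<length lam} (\<lambda>r. {..<lam ! r})"
    by (auto simp: young_diagram_def)
  thus ?thesis by simp
qed

text \<open>The cardinalities in \<^const>\<open>schur\<close> are those of finite sets.\<close>

lemma finite_ssyt_content: "finite {T \<in> ssyt lam. content lam T = m}"
proof (rule finite_subset)
  show "{T \<in> ssyt lam. content lam T = m} \<subseteq> (young_diagram lam \<rightarrow>\<^sub>E Poly_Mapping.keys m)"
  proof
    fix T assume T: "T \<in> {T \<in> ssyt lam. content lam T = m}"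
    have "T b \<in> Poly_Mapping.keys m" if b: "b \<in> young_diagram lam" for b
    proof -
      have "Poly_Mapping.lookup m (T b) = (\<Sum>b'\<in>young_diagram lam. Poly_Mapping.lookup (Poly_Mapping.single (T b') (1::nat)) (T b))"
        using T by (auto simp: content_def lookup_sum)
      also have "\<dots> \<ge> Poly_Mapping.lookup (Poly_Mapping.single (T b) (1::nat)) (T b)"
        by (rule member_le_sum[OF b _ finite_young_diagram]) auto
      finally show ?thesis by (simp add: in_keys_iff)
    qed
    thus "T \<in> young_diagram lam \<rightarrow>\<^sub>E Poly_Mapping.keys m"
      using T by (auto simp: ssyt_def PiE_iff)
  qed
  show "finite (young_diagram lam \<rightarrow>\<^sub>E Poly_Mapping.keys m)"
    by (intro finite_PiE finite_young_diagram) simp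
qed

text \<open>The Schur functions form a basis of \<open>\<Lambda>\<close>, so there is at most one expansion as below.\<close>

definition schur_positive :: "power_series \<Rightarrow> bool" where
  "schur_positive f \<longleftrightarrow> (\<exists>A c. finite A \<and> (\<forall>mu\<in>A. is_partition mu \<and> (c mu :: int) \<ge> 0) \<and>
     f = (\<Sum>mu\<in>A. of_int (c mu) * schur mu))"

definition strongly_schur_log_concave :: "(nat \<Rightarrow> power_series) \<Rightarrow> bool" where
  "strongly_schur_log_concave s \<longleftrightarrow>
     (\<forall>n\<ge>1. \<forall>i. schur_positive (s (n + i) * s n - s (n + i + 1) * s (n - 1)))"

end

theory Submission
  imports Defs "HOL-Combinatorics.Permutations"
begin

text \<open>
  Write \<open>\<alpha>\<close>, \<open>\<beta>\<close> for the shapes of two Schur functions. By the Littlewood--Richardson rule, the coefficient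
  of \<open>s\<^sub>\<nu>\<close> in \<open>s\<^sub>\<alpha> s\<^sub>\<beta>\<close> counts the semistandard tableaux of shape \<open>\<beta>\<close> and content \<open>\<nu> - \<alpha>\<close> that are
  \<open>\<alpha>\<close>-dominant. If \<open>\<alpha>\<^sub>1 \<ge> \<alpha>\<^sub>2 + \<beta>\<^sub>1 + k\<close>, prepending \<open>k\<close> smallest entries to the first row of such a
  tableau yields an \<open>\<alpha>'\<close>-dominant tableau for the pair \<open>\<alpha>'\<close>, \<open>\<beta>'\<close> obtained by moving \<open>k\<close> boxes from the
  first row of \<open>\<alpha>\<close> to that of \<open>\<beta>\<close>; so no coefficient decreases. In the analogous situation \<open>j\<close>
  boxes can be moved between the first columns. Moving first \<open>j\<close> boxes in the column and then \<open>k\<close> boxes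
  in the row turns \<open>(\<lambda>\<^sup>(\<^sup>n\<^sup>+\<^sup>i\<^sup>+\<^sup>1\<^sup>), \<lambda>\<^sup>(\<^sup>n\<^sup>-\<^sup>1\<^sup>))\<close> into \<open>(\<lambda>\<^sup>(\<^sup>n\<^sup>+\<^sup>i\<^sup>), \<lambda>\<^sup>(\<^sup>n\<^sup>))\<close>. The Littlewood--Richardson rule itself is
  proved by Stembridge's sign-reversing involution on alternants.
\<close>

section \<open>Dominant tableaux as Gelfand--Tsetlin patterns\<close>

definition shape :: "(nat \<Rightarrow> nat) \<Rightarrow> bool" where
  "shape a \<longleftrightarrow> antimono a \<and> (\<exists>L. \<forall>r\<ge>L. a r = 0)"

text \<open>
  A tableau of shape \<open>b\<close> is encoded by the numbers \<open>g i r\<close> of entries below \<open>i\<close> in row \<open>r\<close> (rows and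
  entries are counted from \<open>0\<close>), so \<open>g i\<close> is the shape of the subtableau of entries below \<open>i\<close>.
\<close>

definition patterns :: "(nat \<Rightarrow> nat) \<Rightarrow> (nat \<Rightarrow> nat \<Rightarrow> nat) set" where
  "patterns b = {g. (\<forall>r. g 0 r = 0) \<and> (\<forall>i r. g (Suc i) (Suc r) \<le> g i r \<and> g i r \<le> g (Suc i) r) \<and>
     (\<exists>N. \<forall>i\<ge>N. g i = b)}"

definition bounded_patterns :: "nat \<Rightarrow> (nat \<Rightarrow> nat) \<Rightarrow> (nat \<Rightarrow> nat \<Rightarrow> nat) set" where
  "bounded_patterns N b = {g \<in> patterns b. \<forall>i\<ge>N. g i = b}"

text \<open>
  The number of boxes with entry below \<open>i\<close> outside the first \<open>J\<close> columns; rows \<open>r \<ge> i\<close> have no such box.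
\<close>

definition tail_size :: "nat \<Rightarrow> (nat \<Rightarrow> nat \<Rightarrow> nat) \<Rightarrow> nat \<Rightarrow> nat" where
  "tail_size J g i = (\<Sum>r<i. g i r - J)"

definition weight :: "(nat \<Rightarrow> nat \<Rightarrow> nat) \<Rightarrow> nat \<Rightarrow> nat" where
  "weight g v = tail_size 0 g (Suc v) - tail_size 0 g v"

text \<open>
  With the columns from \<open>J\<close> onwards contributing \<open>w\<close> to the content, \<open>a + w\<close> is weakly decreasing; the
  subtractions in \<open>w v = tail_size J g (v + 1) - tail_size J g v\<close> are moved to the other side. The variant
  \<open>row_dominant\<close> below reads the tableau by rows instead: entries \<open>v + 1\<close> in rows up to \<open>r\<close> are compared with
  entries \<open>v\<close> in rows before \<open>r\<close>.
\<close>

definition dominant :: "(nat \<Rightarrow> nat) \<Rightarrow> (nat \<Rightarrow> nat \<Rightarrow> nat) \<Rightarrow> bool" where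
  "dominant a g \<longleftrightarrow> (\<forall>J v. a (Suc v) + tail_size J g (Suc (Suc v)) + tail_size J g v
     \<le> a v + 2 * tail_size J g (Suc v))"

definition row_dominant :: "(nat \<Rightarrow> nat) \<Rightarrow> (nat \<Rightarrow> nat \<Rightarrow> nat) \<Rightarrow> bool" where
  "row_dominant a g \<longleftrightarrow> (\<forall>v r. a (Suc v) + (\<Sum>s\<le>r. g (Suc (Suc v)) s) + (\<Sum>s<r. g v s)
     \<le> a v + (\<Sum>s\<le>r. g (Suc v) s) + (\<Sum>s<r. g (Suc v) s))"

lemma patternsD:
  assumes "g \<in> patterns b"
  shows "g 0 r = 0" "g (Suc i) (Suc r) \<le> g i r" "g i r \<le> g (Suc i) r"
  using assms by (auto simp: patterns_def)

lemma patterns_mono: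
  assumes "g \<in> patterns b" "i \<le> i'" shows "g i r \<le> g i' r"
  by (rule lift_Suc_mono_le[of "\<lambda>i. g i r", OF patternsD(3)[OF assms(1)] assms(2)])

lemma patterns_antimono: 
  assumes "g \<in> patterns b" "r \<le> r'" shows "g i r' \<le> g i r"
proof (rule lift_Suc_antimono_le[OF _ assms(2)])
  show "g i (Suc r) \<le> g i r" for r
    using patternsD(3)[OF assms(1), of i "Suc r"] patternsD(2)[OF assms(1), of i r] by simp
qed

lemma patterns_eq_0: "g \<in> patterns b \<Longrightarrow> i \<le> r \<Longrightarrow> g i r = 0"
proof (induction i arbitrary: r)
  case (Suc i)
  then obtain r' where "r = Suc r'" "i \<le> r'" by (cases r) auto
  thus ?case using Suc patternsD(2)[of g b i r'] by auto
next
  case 0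
  thus ?case using patternsD(1)[of g b r] by simp
qed

lemma patterns_le: assumes "g \<in> patterns b" shows "g i r \<le> b r"
proof -
  obtain N where N: "\<And>i. i \<ge> N \<Longrightarrow> g i = b" using assms by (auto simp: patterns_def)
  have "g i r \<le> g (max i N) r" by (rule patterns_mono[OF assms]) simp
  thus ?thesis using N by simp
qed

lemma tail_size_eq:
  assumes "g \<in> patterns b" "i \<le> R" shows "tail_size J g i = (\<Sum>r<R. g i r - J)"
  unfolding tail_size_def
  by (rule sum.mono_neutral_left) (use assms in \<open>auto simp: patterns_eq_0[OF assms(1)]\<close>)

lemma tail_size_mono: 
  assumes "g \<in> patterns b" "i \<le> i'" shows "tail_size J g i \<le> tail_size J g i'"
  unfolding tail_size_eq[OF assms] tail_size_eq[OF assms(1) order_refl[of i']]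
  by (intro sum_mono diff_le_mono patterns_mono[OF assms])

lemma weight_add: "g \<in> patterns b \<Longrightarrow> weight g v + tail_size 0 g v = tail_size 0 g (Suc v)"
  unfolding weight_def using tail_size_mono[of g b v "Suc v" 0] by auto

lemma weight_eq_0D:
  assumes "g \<in> patterns b" "weight g v = 0" shows "g (Suc v) r = g v r"
proof -
  have *: "(\<Sum>r<R. g v r) = (\<Sum>r<R. g (Suc v) r)" if "Suc v \<le> R" for R
    using weight_add[OF assms(1), of v] that assms(2) tail_size_eq[OF assms(1), of v R 0] tail_size_eq[OF assms(1), of "Suc v" R 0]
    by simp
  have "g v r = g (Suc v) r" if "r < Suc v"
    by (rule sum_mono_inv[OF *]) (use that patternsD(3)[OF assms(1)] in auto)
  thus ?thesis
    using patterns_eq_0[OF assms(1), of v r] patterns_eq_0[OF assms(1), of "Suc v" r] by (cases "r < Suc v") auto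
qed

text \<open>The case \<open>J = 0\<close> of dominance compares neighbouring values of
  \<open>a + weight g\<close>, so each dominant tableau names a partition in the product.\<close>

lemma dominant_shape:
  assumes "dominant a g" "g \<in> patterns b" "shape a" "shape b" shows "shape (\<lambda>v. a v + weight g v)"
proof -
  have "a (Suc v) + weight g (Suc v) \<le> a v + weight g v" for v
    using assms(1)[unfolded dominant_def, rule_format, of v 0] weight_add[OF assms(2), of v] weight_add[OF assms(2), of "Suc v"]
    by linarith
  hence 1: "antimono (\<lambda>v. a v + weight g v)" by (auto simp: antimono_iff_le_Suc)
  obtain N where N: "\<And>i. i \<ge> N \<Longrightarrow> g i = b" using assms by (auto simp: patterns_def)
  obtain L where L: "\<And>r. r \<ge> L \<Longrightarrow> a r = 0" using assms(3) by (auto simp: shape_def)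
  have "weight g v = 0" if "v \<ge> N" for v
    using that tail_size_eq[OF assms(2), of v "Suc v" 0] tail_size_eq[OF assms(2), of "Suc v" "Suc v" 0] N[of v] N[of "Suc v"] by (simp add: weight_def)
  with L have "\<forall>v\<ge>max L N. a v + weight g v = 0" by auto
  with 1 show ?thesis unfolding shape_def by blast
qed

text \<open>Dominance is used with \<open>J = g (Suc v) r\<close>. By interlacing, the rows before
  \<open>r\<close> at all three levels and row \<open>r\<close> at the top level have length at
  least \<open>J\<close>, so truncation can be undone there. The other rows add nothing to the
  larger side and may be dropped from the smaller one.\<close>

lemma dominant_imp_row_dominant:
  assumes g: "g \<in> patterns b" and dominant: "dominant a g" shows "row_dominant a g"
  unfolding row_dominant_def
proof (intro allI)
  fix v r
  define R where "R = Suc (Suc v) + r"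
  define m p q where defs: "m = g v" "p = g (Suc v)" "q = g (Suc (Suc v))"
  have le: "m s \<le> p s" "p s \<le> q s" "p (Suc s) \<le> m s" "q (Suc s) \<le> p s" for s
    using patternsD[OF g] by (auto simp: defs)
  have anti: "s \<le> s' \<Longrightarrow> p s' \<le> p s" for s s' using patterns_antimono[OF g] by (auto simp: defs)
  let ?J = "p r"
  have A: "a (Suc v) + (\<Sum>s<R. q s - ?J) + (\<Sum>s<R. m s - ?J) \<le> a v + 2 * (\<Sum>s<R. p s - ?J)"
    using dominant[unfolded dominant_def, rule_format, of v ?J] 
      tail_size_eq[OF g, of v R ?J] tail_size_eq[OF g, of "Suc v" R ?J] tail_size_eq[OF g, of "Suc (Suc v)" R ?J]
    by (simp add: R_def defs)
  have P: "(\<Sum>s<R. p s - ?J) = (\<Sum>s<r. p s - ?J)"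
    by (rule sum.mono_neutral_right) (use anti in \<open>auto simp: R_def not_less\<close>)
  have P2: "(\<Sum>s<r. p s - ?J) + r * ?J = (\<Sum>s<r. p s)"
  proof -
    have "(\<Sum>s<r. p s - ?J) + (\<Sum>s<r. ?J) = (\<Sum>s<r. p s)"
      unfolding sum.distrib[symmetric] by (intro sum.cong) (use anti in auto)
    thus ?thesis by simp
  qed
  have M: "(\<Sum>s<r. m s - ?J) + r * ?J = (\<Sum>s<r. m s)"
  proof -
    have "?J \<le> m s" if "s < r" for s using le(3)[of s] anti[of "Suc s" r] that by auto
    hence "(\<Sum>s<r. m s - ?J) + (\<Sum>s<r. ?J) = (\<Sum>s<r. m s)"
      unfolding sum.distrib[symmetric] by (intro sum.cong) auto
    thus ?thesis by simp
  qed
  have M2: "(\<Sum>s<r. m s - ?J) \<le> (\<Sum>s<R. m s - ?J)"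
    by (rule sum_mono2) (auto simp: R_def)
  have Q: "(\<Sum>s\<le>r. q s - ?J) + Suc r * ?J = (\<Sum>s\<le>r. q s)"
  proof -
    have "?J \<le> q s" if "s \<le> r" for s using le(2)[of s] anti[of "s" r] that by auto
    hence "(\<Sum>s\<le>r. q s - ?J) + (\<Sum>s\<le>r. ?J) = (\<Sum>s\<le>r. q s)"
      unfolding sum.distrib[symmetric] by (intro sum.cong) auto
    thus ?thesis by simp
  qed
  have Q2: "(\<Sum>s\<le>r. q s - ?J) \<le> (\<Sum>s<R. q s - ?J)"
    by (rule sum_mono2) (auto simp: R_def)
  have P3: "(\<Sum>s\<le>r. p s) = (\<Sum>s<r. p s) + p r"
    by (simp add: lessThan_Suc_atMost[symmetric])
  show "a (Suc v) + (\<Sum>s\<le>r. g (Suc (Suc v)) s) + (\<Sum>s<r. g v s)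
     \<le> a v + (\<Sum>s\<le>r. g (Suc v) s) + (\<Sum>s<r. g (Suc v) s)"
    using A P P2 M M2 Q Q2 P3 unfolding defs[symmetric] by (simp add: algebra_simps)
qed

text \<open>Only the \<open>t\<close> rows of the top level that are longer than \<open>J\<close>
  count. If \<open>t = 0\<close>, the claim is that \<open>a\<close> decreases; otherwise row
  dominance is applied to the last such row.\<close>

lemma row_dominant_imp_dominant:
  assumes g: "g \<in> patterns b" and a: "antimono a" and rg: "row_dominant a g" shows "dominant a g"
  unfolding dominant_def
proof (intro allI)
  fix v J
  define R where "R = Suc (Suc v)"
  define m p q where defs: "m = g v" "p = g (Suc v)" "q = g (Suc (Suc v))"
  have le: "m s \<le> p s" "p s \<le> q s" "p (Suc s) \<le> m s" "q (Suc s) \<le> p s" for s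
    using patternsD[OF g] by (auto simp: defs)
  have anti: "s \<le> s' \<Longrightarrow> q s' \<le> q s" for s s' using patterns_antimono[OF g] by (auto simp: defs)
  have qR: "q R \<le> J" using patterns_eq_0[OF g, of R R] by (simp add: defs R_def)
  define t where "t = (LEAST t. q t \<le> J)"
  have t: "q t \<le> J" unfolding t_def by (rule LeastI[of "\<lambda>t. q t \<le> J", OF qR])
  have tR: "t \<le> R" unfolding t_def by (rule Least_le[of "\<lambda>t. q t \<le> J", OF qR])
  have tq: "J < q s" if "s < t" for s using not_less_Least[of s "\<lambda>t. q t \<le> J"] that t_def by force
  have z: "q s - J = 0" "p s - J = 0" "m s - J = 0" if "t \<le> s" for s
    using anti[OF that] t le[of s] by auto
  have restr: "(\<Sum>s<R. q s - J) = (\<Sum>s<t. q s - J)" "(\<Sum>s<R. p s - J) = (\<Sum>s<t. p s - J)"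
    "(\<Sum>s<R. m s - J) = (\<Sum>s<t. m s - J)"
    by (rule sum.mono_neutral_right; use z tR in \<open>auto simp: not_less\<close>)+
  have "a (Suc v) + (\<Sum>s<R. q s - J) + (\<Sum>s<R. m s - J) \<le> a v + 2 * (\<Sum>s<R. p s - J)"
  proof (cases t)
    case 0
    thus ?thesis using restr a by (simp add: antimono_iff_le_Suc)
  next
    case (Suc r)
    have Q: "(\<Sum>s<r. q s - J) + r * J = (\<Sum>s<r. q s)"
    proof -
      have "(\<Sum>s<r. q s - J) + (\<Sum>s<r. J) = (\<Sum>s<r. q s)"
        unfolding sum.distrib[symmetric]
        by (intro sum.cong) (use tq Suc in \<open>auto intro!: le_add_diff_inverse2 less_imp_le\<close>)
      thus ?thesis by simp
    qed
    have pJ: "J < p s" if "s < r" for s using tq[of "Suc s"] le(4)[of s] that Suc by auto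
    have P: "(\<Sum>s<r. p s - J) + r * J = (\<Sum>s<r. p s)"
    proof -
      have "(\<Sum>s<r. p s - J) + (\<Sum>s<r. J) = (\<Sum>s<r. p s)"
        unfolding sum.distrib[symmetric]
        by (intro sum.cong) (use pJ in \<open>auto intro!: le_add_diff_inverse2 less_imp_le\<close>)
      thus ?thesis by simp
    qed
    \<comment> \<open>Only the last of these rows can be shorter than \<open>J\<close>, by at most
      \<open>J - p r\<close> since \<open>p (Suc r') \<le> m r'\<close>. This loss is regained from
      row \<open>r\<close> of the middle level.\<close>
    have M: "(\<Sum>s<r. m s - J) + r * J \<le> (\<Sum>s<r. m s) + (J - p r)"
    proof (cases r)
      case (Suc r')
      have "(\<Sum>s<r'. m s - J) + (\<Sum>s<r'. J) = (\<Sum>s<r'. m s)"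
        unfolding sum.distrib[symmetric]
      proof (intro sum.cong)
        fix s assume "s \<in> {..<r'}"
        hence "J < m s" using pJ[of "Suc s"] le(3)[of s] Suc by auto
        thus "m s - J + J = m s" by simp
      qed simp
      moreover have "m r' - J + J \<le> m r' + (J - p r)" using le(3)[of r'] Suc by simp
      ultimately show ?thesis using Suc by (simp add: algebra_simps)
    qed simp
    have 1: "q r > J" using tq Suc by simp
    have 2: "m r \<le> p r" by (rule le)
    have "a (Suc v) + (\<Sum>s\<le>r. q s) + (\<Sum>s<r. m s) \<le> a v + (\<Sum>s\<le>r. p s) + (\<Sum>s<r. p s)"
      using rg unfolding row_dominant_def defs by blast
    hence 3: "a (Suc v) + (\<Sum>s<r. q s) + q r + (\<Sum>s<r. m s) \<le> a v + (\<Sum>s<r. p s) + p r + (\<Sum>s<r. p s)"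
      by (simp add: lessThan_Suc_atMost[symmetric])
    obtain x where x: "q r = x + J" using 1 by (metis add.commute le_iff_add less_imp_le_nat)
    have "a (Suc v) + ((\<Sum>s<r. q s - J) + (q r - J)) + ((\<Sum>s<r. m s - J) + (m r - J))
        \<le> a v + 2 * ((\<Sum>s<r. p s - J) + (p r - J))"
    proof (cases "p r \<le> J")
      case True
      then obtain y where "J = p r + y" by (auto simp: le_iff_add)
      moreover have "m r - J = 0" "p r - J = 0" "q r - J = x" using True 2 x by auto
      ultimately show ?thesis using Q P M 3 x by simp
    next
      case False
      then obtain y where "p r = y + J" by (metis add.commute le_iff_add nat_le_linear)
      moreover have "m r - J \<le> y" "p r - J = y" "q r - J = x" using calculation 2 x by auto
      ultimately show ?thesis using Q P M 3 x by simp
    qed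
    thus ?thesis by (simp add: restr Suc)
  qed
  thus "a (Suc v) + tail_size J g (Suc (Suc v)) + tail_size J g v \<le> a v + 2 * tail_size J g (Suc v)"
    using tail_size_eq[OF g, of v R J] tail_size_eq[OF g, of "Suc v" R J] tail_size_eq[OF g, of "Suc (Suc v)" R J]
    by (simp add: R_def defs)
qed

text \<open>
  While \<open>a\<close> does not decrease, an entry \<open>v + 1\<close> in row \<open>r\<close> forces an entry \<open>v\<close> in an earlier row, so entries
  \<open>c + s\<close> can occur only in rows from \<open>s\<close> onwards.
\<close>

lemma dominant_const_run:
  assumes g: "g \<in> patterns b" and dominant: "dominant a g"
    and run: "\<And>v. c \<le> v \<Longrightarrow> Suc v < d \<Longrightarrow> a v \<le> a (Suc v)"
    and "c + s < d" "r < s"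
  shows "g (Suc (c + s)) r = g (c + s) r"
proof -
  have "c + s < d \<Longrightarrow> (\<Sum>r<s. g (Suc (c + s)) r) = (\<Sum>r<s. g (c + s) r)" for s
  proof (induction s)
    case (Suc s)
    have "a (c + Suc s) + (\<Sum>r\<le>s. g (Suc (c + Suc s)) r) + (\<Sum>r<s. g (c + s) r) \<le>
       a (c + s) + (\<Sum>r\<le>s. g (c + Suc s) r) + (\<Sum>r<s. g (Suc (c + s)) r)"
      using dominant_imp_row_dominant[OF g dominant, unfolded row_dominant_def, rule_format, of "c + s" s] by simp
    with Suc run[of "c + s"] have "(\<Sum>r<Suc s. g (Suc (c + Suc s)) r) \<le> (\<Sum>r<Suc s. g (c + Suc s) r)"
      unfolding lessThan_Suc_atMost by simp
    moreover have "(\<Sum>r<Suc s. g (Suc (c + Suc s)) r) \<ge> (\<Sum>r<Suc s. g (c + Suc s) r)"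
      by (intro sum_mono patternsD[OF g])
    ultimately show ?case by simp
  qed simp
  hence *: "(\<Sum>r<s. g (c + s) r) = (\<Sum>r<s. g (Suc (c + s)) r)" using assms(4) by simp
  show ?thesis using sum_mono_inv[OF *, of r] patternsD[OF g] assms(5) by simp
qed

section \<open>Littlewood-Richardson tableaux and their finiteness\<close>

definition LR_patterns :: "(nat \<Rightarrow> nat) \<Rightarrow> (nat \<Rightarrow> nat) \<Rightarrow> (nat \<Rightarrow> nat \<Rightarrow> nat) set" where
  "LR_patterns a b = {g \<in> patterns b. dominant a g}"

text \<open>The zeros of \<open>a\<close> from \<open>L\<close> on form an endless constant run, so
  row \<open>r\<close> holds no entry beyond \<open>L + r\<close>.\<close>

lemma dominant_stable:
  assumes g: "g \<in> patterns b" and dominant: "dominant a g"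
    and a: "\<And>r. r \<ge> L \<Longrightarrow> a r = 0" and "L + r < i"
  shows "g i r = b r"
proof -
  obtain N where N: "\<And>i. i \<ge> N \<Longrightarrow> g i = b" using g by (auto simp: patterns_def)
  have "g (i + n) r = g i r" for n
  proof (induction n)
    case (Suc n)
    have "g (Suc (L + (i + n - L))) r = g (L + (i + n - L)) r"
      by (rule dominant_const_run[OF g dominant, of L "Suc (L + (i + n - L))"]) (use a assms(4) in auto)
    thus ?case using Suc assms(4) by simp
  qed simp
  from this[of N] show ?thesis using N[of "i + N"] by simp
qed

text \<open>Dominance itself bounds the entries, so for all large \<open>N\<close> the variables
  below \<open>N\<close> see every dominant tableau.\<close>

lemma LR_patterns_subset_bounded_patterns:
  assumes a: "\<And>r. r \<ge> L \<Longrightarrow> a r = 0" and b: "\<And>r. r \<ge> M \<Longrightarrow> b r = 0" and "L + M \<le> N"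
  shows "LR_patterns a b = {g \<in> bounded_patterns N b. dominant a g}"
proof -
  have "g i r = b r" if g: "g \<in> patterns b" and dominant: "dominant a g" and "N \<le> i" for g i r
  proof (cases "r < M")
    case True
    thus ?thesis using dominant_stable[OF g dominant a, of L r i] that assms(3) by simp
  next
    case False
    thus ?thesis using patterns_le[OF g, of i r] b[of r] by simp
  qed
  thus ?thesis by (auto simp: LR_patterns_def bounded_patterns_def)
qed

lemma finite_bounded_patterns:
  assumes b: "shape b" shows "finite (bounded_patterns N b)"
proof -
  let ?f = "\<lambda>g :: nat \<Rightarrow> nat \<Rightarrow> nat. restrict (\<lambda>(i, r). g i r) ({..<N} \<times> {..<N})"
  have "?f ` bounded_patterns N b \<subseteq> ({..<N} \<times> {..<N}) \<rightarrow>\<^sub>E {..b 0}"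
  proof clarify
    fix g assume "g \<in> bounded_patterns N b"
    hence g: "g \<in> patterns b" by (simp add: bounded_patterns_def)
    have "g i r \<le> b 0" for i r
      using patterns_le[OF g, of i r] b antimonoD[of b 0 r] by (auto simp: shape_def intro: order_trans)
    thus "?f g \<in> ({..<N} \<times> {..<N}) \<rightarrow>\<^sub>E {..b 0}" by auto
  qed
  hence "finite (?f ` bounded_patterns N b)" by (rule finite_subset) (intro finite_PiE, auto)
  moreover have "inj_on ?f (bounded_patterns N b)"
  proof (intro inj_onI ext)
    fix g h i r assume gh: "g \<in> bounded_patterns N b" "h \<in> bounded_patterns N b" and eq: "?f g = ?f h"
    show "g i r = h i r"
    proof (cases "i < N \<and> r < N")
      case True
      thus ?thesis using fun_cong[OF eq, of "(i, r)"] by simp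
    next
      case False
      thus ?thesis using gh patterns_eq_0[of g b i r] patterns_eq_0[of h b i r] by (cases "i < N") (auto simp: bounded_patterns_def)
    qed
  qed
  ultimately show ?thesis by (rule finite_imageD)
qed

lemma finite_LR_patterns: assumes "shape a" "shape b" shows "finite (LR_patterns a b)"
proof -
  obtain L M where "\<And>r. r \<ge> L \<Longrightarrow> a r = 0" "\<And>r. r \<ge> M \<Longrightarrow> b r = 0"
    using assms by (auto simp: shape_def)
  hence "LR_patterns a b = {g \<in> bounded_patterns (L + M) b. dominant a g}" by (intro LR_patterns_subset_bounded_patterns) auto
  thus ?thesis using finite_bounded_patterns[OF assms(2)] by simp
qed

section \<open>Bender--Knuth involutions\<close>

text \<open>The Bender-Knuth move in Gelfand-Tsetlin form: \<open>p r\<close> is reflected in the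
  interval left by its neighbours in the adjacent levels, with the upper end capped at
  \<open>J\<close>. Row \<open>0\<close> has no neighbour \<open>m s\<close>. Under the assumption
  \<open>beyond\<close>, a row with \<open>J < p r\<close> has neither \<open>v\<close> nor
  \<open>v + 1\<close> in the first \<open>J\<close> columns and stays fixed.\<close>

definition toggle_row :: "nat \<Rightarrow> (nat \<Rightarrow> nat) \<Rightarrow> (nat \<Rightarrow> nat) \<Rightarrow> (nat \<Rightarrow> nat) \<Rightarrow> nat \<Rightarrow> nat" where
  "toggle_row J m p q r = (if J < p r then p r
     else min J (case r of 0 \<Rightarrow> q 0 | Suc s \<Rightarrow> min (q r) (m s)) + max (q (Suc r)) (m r) - p r)"

text \<open>
  Exchanges the numbers of entries \<open>v\<close> and \<open>v + 1\<close> in the first \<open>J\<close> columns. The columns from \<open>J\<close>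
  onwards are not affected, provided that column \<open>J\<close> contains no \<open>v\<close> (assumption \<open>beyond\<close> below).
\<close>

definition toggle :: "nat \<Rightarrow> nat \<Rightarrow> (nat \<Rightarrow> nat \<Rightarrow> nat) \<Rightarrow> nat \<Rightarrow> nat \<Rightarrow> nat" where
  "toggle J v g = g(Suc v := toggle_row J (g v) (g (Suc v)) (g (Suc (Suc v))))"

locale interlacing =
  fixes J :: nat and m p q :: "nat \<Rightarrow> nat"
  assumes m_le: "m r \<le> p r" and p_le: "p r \<le> q r"
    and p_Suc: "p (Suc r) \<le> m r" and q_Suc: "q (Suc r) \<le> p r"
    and beyond: "J < p r \<Longrightarrow> J < m r"
begin

lemma bounds:
  shows "max (q (Suc r)) (m r) \<le> p r" "p r \<le> (case r of 0 \<Rightarrow> q 0 | Suc s \<Rightarrow> min (q r) (m s))"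
  using m_le q_Suc p_le p_Suc by (auto split: nat.split)

lemma toggle_row_le_iff: "J < toggle_row J m p q r \<longleftrightarrow> J < p r"
  using bounds[of r] by (auto simp: toggle_row_def)

lemma toggle_row_diff: "J \<le> J' \<Longrightarrow> toggle_row J m p q r - J' = p r - J'"
  using toggle_row_le_iff[of r] by (cases "J < p r") (auto simp: toggle_row_def)

lemma toggle_row_bounds:
  shows "m r \<le> toggle_row J m p q r" "toggle_row J m p q r \<le> q r"
    "toggle_row J m p q (Suc r) \<le> m r" "q (Suc r) \<le> toggle_row J m p q r"
  using bounds[of r] bounds[of "Suc r"] p_le[of r] m_le[of r] p_Suc[of r] q_Suc[of r]
  by (auto simp: toggle_row_def min_def max_def split: nat.splits if_splits)

lemma toggle_row_toggle_row: "toggle_row J m (toggle_row J m p q) q r = p r"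
proof (cases "J < p r")
  case False
  thus ?thesis using bounds[of r] toggle_row_le_iff[of r]
    by (auto simp: toggle_row_def)
qed (auto simp: toggle_row_def)

lemma toggle_row_min:
  "min J (toggle_row J m p q r) + min J (p r) =
   min J (case r of 0 \<Rightarrow> q 0 | Suc s \<Rightarrow> min (q r) (m s)) + min J (max (q (Suc r)) (m r))"
proof (cases "J < p r")
  case True
  with beyond[of r] bounds[of r] show ?thesis by (auto simp: toggle_row_def)
next
  case False
  with bounds[of r] show ?thesis by (auto simp: toggle_row_def)
qed

text \<open>The interval ends telescope: the lower end in row \<open>R\<close> and the upper end in
  row \<open>R + 1\<close> are the maximum and the minimum of the same two numbers.\<close>

lemma sum_toggle_row_min_aux:
  "(\<Sum>r<Suc R. min J (toggle_row J m p q r) + min J (p r)) =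
    (\<Sum>r<Suc R. min J (q r)) + (\<Sum>r<R. min J (m r)) + min J (max (q (Suc R)) (m R))"
proof (induction R)
  case (Suc R)
  have "min J (max (q (Suc R)) (m R)) + min J (min (q (Suc R)) (m R)) = min J (q (Suc R)) + min J (m R)"
    by (auto simp: min_def max_def)
  with Suc show ?case using toggle_row_min[of "Suc R"] by simp
qed (simp add: toggle_row_min)

text \<open>Each row is split at column \<open>J\<close>. In the first \<open>J\<close> columns, new
  plus old middle level equals lower plus upper level, which exchanges the numbers of
  \<open>v\<close> and \<open>v + 1\<close>; the other columns are unchanged.\<close>

lemma sum_toggle_row:
  assumes "q R = 0"
  shows "(\<Sum>r<R. toggle_row J m p q r) + (\<Sum>r<R. p r) + (\<Sum>r<R. m r - J) + (\<Sum>r<R. q r - J)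
    = (\<Sum>r<R. m r) + (\<Sum>r<R. q r) + 2 * (\<Sum>r<R. p r - J)"
proof (cases R)
  case (Suc R')
  have *: "(\<Sum>r<R. f r) = (\<Sum>r<R. min J (f r)) + (\<Sum>r<R. f r - J)" for f :: "nat \<Rightarrow> nat"
    unfolding sum.distrib[symmetric] by (intro sum.cong) auto
  have "(\<Sum>r<R. toggle_row J m p q r - J) = (\<Sum>r<R. p r - J)"
    by (simp add: toggle_row_diff)
  moreover have "(\<Sum>r<R. min J (toggle_row J m p q r)) + (\<Sum>r<R. min J (p r)) =
      (\<Sum>r<R. min J (q r)) + (\<Sum>r<R. min J (m r))"
    using sum_toggle_row_min_aux[of R'] assms by (simp add: Suc sum.distrib)
  ultimately show ?thesis
    using *[of m] *[of p] *[of q] *[of "toggle_row J m p q"] by linarith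
qed simp

end

lemma toggle_neq: "i \<noteq> Suc v \<Longrightarrow> toggle J v g i = g i"
  by (simp add: toggle_def)

lemma interlacing_patterns:
  assumes "g \<in> patterns b" "\<And>r. J < g (Suc v) r \<Longrightarrow> J < g v r"
  shows "interlacing J (g v) (g (Suc v)) (g (Suc (Suc v)))"
  by unfold_locales (use assms(2) patternsD[OF assms(1)] in auto)

lemma toggle_bounded_patterns:
  assumes g: "g \<in> bounded_patterns N b" and "Suc v < N" and J: "\<And>r. J < g (Suc v) r \<Longrightarrow> J < g v r"
  shows "toggle J v g \<in> bounded_patterns N b"
proof -
  have g': "g \<in> patterns b" using g by (simp add: bounded_patterns_def)
  interpret interlacing J "g v" "g (Suc v)" "g (Suc (Suc v))"
    by (rule interlacing_patterns[OF g' J])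
  let ?h = "toggle J v g"
  have "?h (Suc i) (Suc r) \<le> ?h i r \<and> ?h i r \<le> ?h (Suc i) r" for i r
  proof -
    consider "i = v" | "i = Suc v" | "i \<noteq> v" "i \<noteq> Suc v" by blast
    thus ?thesis
    proof cases
      case 1
      thus ?thesis using toggle_row_bounds[of r] by (simp add: toggle_def)
    next
      case 2
      thus ?thesis using toggle_row_bounds[of r] by (simp add: toggle_def)
    next
      case 3
      thus ?thesis using patternsD[OF g'] by (simp add: toggle_def)
    qed
  qed
  moreover have "\<forall>i\<ge>N. ?h i = b"
    using g assms(2) by (auto simp: bounded_patterns_def toggle_def)
  moreover have "?h 0 r = 0" for r
    using patternsD(1)[OF g'] by (simp add: toggle_def)
  ultimately show ?thesis unfolding bounded_patterns_def patterns_def by blast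
qed

lemma toggle_toggle:
  assumes "g \<in> patterns b" "\<And>r. J < g (Suc v) r \<Longrightarrow> J < g v r"
  shows "toggle J v (toggle J v g) = g"
  using interlacing.toggle_row_toggle_row[OF interlacing_patterns[OF assms]]
  by (auto simp: toggle_def fun_eq_iff)

lemma tail_size_toggle_neq: "i \<noteq> Suc v \<Longrightarrow> tail_size J' (toggle J v g) i = tail_size J' g i"
  by (simp add: tail_size_def toggle_neq)

lemma tail_size_toggle_ge:
  assumes "g \<in> patterns b" "\<And>r. J < g (Suc v) r \<Longrightarrow> J < g v r" "J \<le> J'"
  shows "tail_size J' (toggle J v g) i = tail_size J' g i"
  using interlacing.toggle_row_diff[OF interlacing_patterns[OF assms(1,2)] assms(3)]
  by (cases "i = Suc v") (auto simp: tail_size_def toggle_def)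

lemma tail_size_toggle:
  assumes g: "g \<in> bounded_patterns N b" and "Suc v < N" and J: "\<And>r. J < g (Suc v) r \<Longrightarrow> J < g v r"
  shows "tail_size 0 (toggle J v g) (Suc v) + tail_size 0 g (Suc v) + tail_size J g v + tail_size J g (Suc (Suc v))
    = tail_size 0 g v + tail_size 0 g (Suc (Suc v)) + 2 * tail_size J g (Suc v)"
proof -
  have g': "g \<in> patterns b" using g by (simp add: bounded_patterns_def)
  interpret interlacing J "g v" "g (Suc v)" "g (Suc (Suc v))"
    by (rule interlacing_patterns[OF g' J])
  have h: "toggle J v g \<in> patterns b" using toggle_bounded_patterns[OF assms] by (simp add: bounded_patterns_def)
  let ?R = "Suc (Suc v)"
  have "g ?R ?R = 0" using patterns_eq_0[OF g'] by simp
  from sum_toggle_row[OF this] show ?thesis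
    using tail_size_eq[OF g', of v ?R] tail_size_eq[OF g', of "Suc v" ?R] tail_size_eq[OF g', of ?R ?R]
      tail_size_eq[OF h, of "Suc v" ?R]
    by (simp add: toggle_def)
qed

section \<open>The Littlewood--Richardson rule\<close>

definition monomial_exp :: "nat \<Rightarrow> (nat \<Rightarrow> nat) \<Rightarrow> (nat \<Rightarrow>\<^sub>0 nat)" where
  "monomial_exp N e = (\<Sum>i<N. Poly_Mapping.single i (e i))"

definition alternant :: "nat \<Rightarrow> (nat \<Rightarrow> nat) \<Rightarrow> (nat \<Rightarrow>\<^sub>0 nat) \<Rightarrow>\<^sub>0 int" where
  "alternant N e = (\<Sum>p | p permutes {..<N}. Poly_Mapping.single (monomial_exp N (e \<circ> p)) (sign p))"

definition schur_poly :: "nat \<Rightarrow> (nat \<Rightarrow> nat) \<Rightarrow> (nat \<Rightarrow>\<^sub>0 nat) \<Rightarrow>\<^sub>0 int" where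
  "schur_poly N b = (\<Sum>g\<in>bounded_patterns N b. Poly_Mapping.single (monomial_exp N (weight g)) 1)"

lemma lookup_monomial_exp: "Poly_Mapping.lookup (monomial_exp N e) i = (if i < N then e i else 0)"
  by (simp add: monomial_exp_def lookup_sum lookup_single when_def)

lemma monomial_exp_cong: "(\<And>i. i < N \<Longrightarrow> e i = f i) \<Longrightarrow> monomial_exp N e = monomial_exp N f"
  by (rule poly_mapping_eqI) (simp add: lookup_monomial_exp)

lemma monomial_exp_add: "monomial_exp N (\<lambda>i. e i + f i) = monomial_exp N e + monomial_exp N f"
  by (rule poly_mapping_eqI) (simp add: lookup_monomial_exp lookup_add)

lemma alternant_cong: "(\<And>i. i < N \<Longrightarrow> e i = f i) \<Longrightarrow> alternant N e = alternant N f"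
  unfolding alternant_def
  by (intro sum.cong refl arg_cong2[of _ _ _ _ Poly_Mapping.single] monomial_exp_cong)
    (auto dest: permutes_in_image)

lemma alternant_transpose:
  assumes "u < N" "v < N" "u \<noteq> v"
  shows "alternant N (e \<circ> Transposition.transpose u v) = - alternant N e"
proof -
  let ?t = "Transposition.transpose u v"
  have t: "?t permutes {..<N}" using assms by (intro permutes_swap_id) auto
  have "alternant N e = (\<Sum>p | p permutes {..<N}. Poly_Mapping.single (monomial_exp N (e \<circ> (?t \<circ> p))) (sign (?t \<circ> p)))"
    unfolding alternant_def by (rule setum_permutations_compose_left[OF t])
  also have "\<dots> = (\<Sum>p | p permutes {..<N}. - Poly_Mapping.single (monomial_exp N (e \<circ> ?t \<circ> p)) (sign p))"
  proof (intro sum.cong refl)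
    fix p assume "p \<in> {p. p permutes {..<N}}"
    hence "sign (?t \<circ> p) = - sign p"
      using t assms by (subst sign_compose) (auto simp: sign_swap_id permutes_imp_permutation[of "{..<N}"])
    thus "Poly_Mapping.single (monomial_exp N (e \<circ> (?t \<circ> p))) (sign (?t \<circ> p)) =
        - Poly_Mapping.single (monomial_exp N (e \<circ> ?t \<circ> p)) (sign p)"
      by (simp add: single_uminus o_assoc)
  qed
  finally show ?thesis by (simp add: sum_negf alternant_def)
qed

lemma weight_toggle:
  assumes g: "g \<in> bounded_patterns N b" and v: "Suc v < N" and J: "\<And>r. J < g (Suc v) r \<Longrightarrow> J < g v r"
  shows "weight (toggle J v g) v + tail_size J g v + tail_size J g (Suc (Suc v)) = weight g (Suc v) + 2 * tail_size J g (Suc v)"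
    "weight (toggle J v g) (Suc v) + 2 * tail_size J g (Suc v) = weight g v + tail_size J g v + tail_size J g (Suc (Suc v))"
    "i \<noteq> v \<Longrightarrow> i \<noteq> Suc v \<Longrightarrow> weight (toggle J v g) i = weight g i"
proof -
  let ?h = "toggle J v g"
  have g': "g \<in> patterns b" using g by (simp add: bounded_patterns_def)
  have h: "?h \<in> patterns b" using toggle_bounded_patterns[OF g v J] by (simp add: bounded_patterns_def)
  note * = tail_size_toggle[OF g v J] weight_add[OF g', of v] weight_add[OF h, of v]
    weight_add[OF g', of "Suc v"] weight_add[OF h, of "Suc v"]
    tail_size_toggle_neq[of v v 0 J g] tail_size_toggle_neq[of "Suc (Suc v)" v 0 J g]
  show "weight (toggle J v g) v + tail_size J g v + tail_size J g (Suc (Suc v)) = weight g (Suc v) + 2 * tail_size J g (Suc v)"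
    using * by simp
  show "weight (toggle J v g) (Suc v) + 2 * tail_size J g (Suc v) = weight g v + tail_size J g v + tail_size J g (Suc (Suc v))"
    using * by simp
  show "i \<noteq> v \<Longrightarrow> i \<noteq> Suc v \<Longrightarrow> weight (toggle J v g) i = weight g i"
    by (simp add: weight_def tail_size_toggle_neq)
qed

lemma patterns_tail_size_zero:
  assumes "g \<in> patterns b" "shape b" "b 0 \<le> J" shows "tail_size J g i = 0"
proof -
  have "g i r \<le> J" for r
    using patterns_le[OF assms(1), of i r] assms(2,3) antimonoD[of b 0 r] by (auto simp: shape_def)
  thus ?thesis by (simp add: tail_size_def)
qed

text \<open>With \<open>J = b 0\<close> no row is cut off, and the toggle is the full Bender-Knuth
  involution. The free function \<open>F\<close> makes the symmetry usable inside other
  sums.\<close>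

lemma sum_bounded_patterns_adjacent_transposition:
  fixes F :: "(nat \<Rightarrow>\<^sub>0 nat) \<Rightarrow> 'a :: comm_monoid_add"
  assumes b: "shape b" and v: "Suc v < N"
  shows "(\<Sum>g\<in>bounded_patterns N b. F (monomial_exp N (weight g \<circ> Transposition.transpose v (Suc v)))) =
    (\<Sum>g\<in>bounded_patterns N b. F (monomial_exp N (weight g)))"
proof -
  let ?T = "toggle (b 0) v"
  have J: "\<not> b 0 < g i r" if "g \<in> bounded_patterns N b" for g i r
    using that patterns_le[of g b i r] b antimonoD[of b 0 r] by (auto simp: shape_def bounded_patterns_def)
  have g': "g \<in> patterns b" if "g \<in> bounded_patterns N b" for g using that by (simp add: bounded_patterns_def)
  have z: "tail_size (b 0) g i = 0" if "g \<in> bounded_patterns N b" for g i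
    using patterns_tail_size_zero[OF g'[OF that] b] by simp
  have "weight g \<circ> Transposition.transpose v (Suc v) = weight (?T g)" if g: "g \<in> bounded_patterns N b" for g
    using weight_toggle[OF g v, of "b 0"] J[OF g] z[OF g]
    by (auto simp: fun_eq_iff Transposition.transpose_def)
  moreover have "?T (?T g) = g" if g: "g \<in> bounded_patterns N b" for g
    by (rule toggle_toggle[OF g'[OF g]]) (use J[OF g] in auto)
  moreover have "?T g \<in> bounded_patterns N b" if g: "g \<in> bounded_patterns N b" for g
    by (rule toggle_bounded_patterns[OF g v]) (use J[OF g] in auto)
  ultimately show ?thesis
    by (intro sum.reindex_bij_witness[of _ ?T ?T]) auto
qed

lemma sum_bounded_patterns_permutation:
  fixes F :: "(nat \<Rightarrow>\<^sub>0 nat) \<Rightarrow> 'a :: comm_monoid_add"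
  assumes b: "shape b" and p: "p permutes {..<N}"
  shows "(\<Sum>g\<in>bounded_patterns N b. F (monomial_exp N (weight g \<circ> p))) = (\<Sum>g\<in>bounded_patterns N b. F (monomial_exp N (weight g)))"
proof -
  \<comment> \<open>\<open>F\<close> is quantified inside \<open>P\<close> because a composition
    needs the first symmetry for \<open>F\<close> combined with a permutation of variables.\<close>
  define P where "P p \<longleftrightarrow> p permutes {..<N} \<and> (\<forall>F :: (nat \<Rightarrow>\<^sub>0 nat) \<Rightarrow> 'a.
    (\<Sum>g\<in>bounded_patterns N b. F (monomial_exp N (weight g \<circ> p))) = (\<Sum>g\<in>bounded_patterns N b. F (monomial_exp N (weight g))))" for p
  have P_comp: "P (p \<circ> q)" if "P p" "P q" for p q
    unfolding P_def
  proof (intro conjI allI)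
    show pq: "p \<circ> q permutes {..<N}" using that by (auto simp: P_def intro: permutes_compose)
    fix F :: "(nat \<Rightarrow>\<^sub>0 nat) \<Rightarrow> 'a"
    have eq: "monomial_exp N (Poly_Mapping.lookup (monomial_exp N e) \<circ> q) = monomial_exp N (e \<circ> q)" for e
      by (intro monomial_exp_cong) (use that in \<open>auto simp: P_def lookup_monomial_exp dest: permutes_in_image\<close>)
    have "(\<Sum>g\<in>bounded_patterns N b. F (monomial_exp N (weight g \<circ> (p \<circ> q)))) = (\<Sum>g\<in>bounded_patterns N b. F (monomial_exp N (weight g \<circ> q)))"
      using that(1)[unfolded P_def, THEN conjunct2, rule_format, of "\<lambda>x. F (monomial_exp N (Poly_Mapping.lookup x \<circ> q))"]
      by (simp add: eq o_assoc)
    also have "\<dots> = (\<Sum>g\<in>bounded_patterns N b. F (monomial_exp N (weight g)))"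
      using that(2) by (simp add: P_def)
    finally show "(\<Sum>g\<in>bounded_patterns N b. F (monomial_exp N (weight g \<circ> (p \<circ> q)))) = (\<Sum>g\<in>bounded_patterns N b. F (monomial_exp N (weight g)))" .
  qed
  have adj: "P (Transposition.transpose v (Suc v))" if "Suc v < N" for v
    using sum_bounded_patterns_adjacent_transposition[OF b that] that unfolding P_def
    by (auto intro: permutes_swap_id)
  have far: "P (Transposition.transpose u (u + Suc n))" if "u + Suc n < N" for u n
    using that
  proof (induction n)
    case (Suc n)
    have *: "Transposition.transpose u (u + Suc (Suc n)) =
      Transposition.transpose (u + Suc n) (Suc (u + Suc n)) \<circ> Transposition.transpose u (u + Suc n) \<circ>
        Transposition.transpose (u + Suc n) (Suc (u + Suc n))"
      by (auto simp: fun_eq_iff Transposition.transpose_def)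
    show ?case unfolding * using Suc adj[of "u + Suc n"] by (intro P_comp) auto
  qed (use adj in auto)
  have tr: "P (Transposition.transpose u v)" if "u < N" "v < N" "u \<noteq> v" for u v
  proof -
    have less: "P (Transposition.transpose u v)" if "u < v" "v < N" for u v
      using far[of u "v - Suc u"] that by simp
    from \<open>u \<noteq> v\<close> consider "u < v" | "v < u" by linarith
    thus ?thesis
      using less[of u v] less[of v u] that by cases (auto simp: transpose_commute)
  qed
  have "P p"
    using p finite_lessThan[of N]
  proof (induction rule: permutes_induct)
    case id
    show ?case by (simp add: P_def permutes_id[unfolded id_def] id_def o_def)
  next
    case (swap u v p)
    thus ?case by (intro P_comp tr) auto
  qed
  thus ?thesis by (simp add: P_def)
qed

text \<open>By symmetry, the weights in the summand of \<open>p\<close> may be permuted by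
  \<open>p\<close> as well; exchanging the sums then collects one alternant per tableau.\<close>

lemma alternant_mult_schur_poly:
  assumes b: "shape b"
  shows "alternant N e * schur_poly N b = (\<Sum>g\<in>bounded_patterns N b. alternant N (\<lambda>i. e i + weight g i))"
proof -
  have "alternant N e * schur_poly N b =
    (\<Sum>p | p permutes {..<N}. \<Sum>g\<in>bounded_patterns N b. Poly_Mapping.single (monomial_exp N (e \<circ> p) + monomial_exp N (weight g)) (sign p))"
    unfolding alternant_def schur_poly_def sum_product by (simp add: mult_single)
  also have "\<dots> = (\<Sum>p | p permutes {..<N}. \<Sum>g\<in>bounded_patterns N b. Poly_Mapping.single (monomial_exp N (e \<circ> p) + monomial_exp N (weight g \<circ> p)) (sign p))"
    by (intro sum.cong refl sum_bounded_patterns_permutation[OF b, symmetric]) simp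
  also have "\<dots> = (\<Sum>g\<in>bounded_patterns N b. \<Sum>p | p permutes {..<N}. Poly_Mapping.single (monomial_exp N (e \<circ> p) + monomial_exp N (weight g \<circ> p)) (sign p))"
    by (rule sum.swap)
  also have "\<dots> = (\<Sum>g\<in>bounded_patterns N b. alternant N (\<lambda>i. e i + weight g i))"
    unfolding alternant_def monomial_exp_add[symmetric] by (simp add: o_def)
  finally show ?thesis .
qed


text \<open>
  Stembridge's cancellation: look for the last column violating dominance and the smallest entry \<open>v\<close> doing
  so there. That column contains \<open>v + 1\<close> but not \<open>v\<close>, and toggling \<open>v\<close> in the columns before it transposes two
  coordinates of the exponent vector of the alternant.
\<close>

definition bad_at :: "(nat \<Rightarrow> nat) \<Rightarrow> (nat \<Rightarrow> nat \<Rightarrow> nat) \<Rightarrow> nat \<Rightarrow> nat \<Rightarrow> bool" where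
  "bad_at a g J v \<longleftrightarrow> a v + 2 * tail_size J g (Suc v)
     < a (Suc v) + tail_size J g (Suc (Suc v)) + tail_size J g v"

definition last_bad_at :: "(nat \<Rightarrow> nat) \<Rightarrow> (nat \<Rightarrow> nat \<Rightarrow> nat) \<Rightarrow> nat \<times> nat \<Rightarrow> bool" where
  "last_bad_at a g = (\<lambda>(J, v). bad_at a g J v \<and> (\<forall>u<v. \<not> bad_at a g J u) \<and> (\<forall>J'>J. \<forall>u. \<not> bad_at a g J' u))"

lemma dominant_iff: "dominant a g \<longleftrightarrow> (\<forall>J v. \<not> bad_at a g J v)"
  by (simp add: dominant_def bad_at_def not_less)

lemma last_bad_at_unique: "last_bad_at a g x \<Longrightarrow> last_bad_at a g y \<Longrightarrow> x = y"
  unfolding last_bad_at_def case_prod_unfold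
  by (metis linorder_neqE_nat prod.expand)

lemma ex_last_bad_at:
  assumes g: "g \<in> patterns b" and b: "shape b" and a: "antimono a" and "\<not> dominant a g"
  shows "\<exists>x. last_bad_at a g x"
proof -
  define P where "P J \<longleftrightarrow> (\<exists>v. bad_at a g J v)" for J
  \<comment> \<open>For \<open>J\<close> above \<open>b 0\<close> all tails vanish and only the
    monotonicity of \<open>a\<close> remains, so there is a last bad column.\<close>
  have bound: "J \<le> b 0" if "P J" for J
  proof (rule ccontr)
    assume "\<not> J \<le> b 0"
    hence "tail_size J g i = 0" for i using patterns_tail_size_zero[OF g b] by simp
    moreover have "a (Suc v) \<le> a v" for v using a by (simp add: antimono_iff_le_Suc)
    ultimately show False using that by (auto simp: P_def bad_at_def simp flip: not_le)
  qed
  from assms(4) obtain J0 where J0: "P J0" by (auto simp: dominant_iff P_def)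
  define J where "J = (GREATEST J. P J)"
  have "P J" unfolding J_def by (rule GreatestI_nat[of P J0 "b 0", OF J0 bound])
  define v where "v = (LEAST v. bad_at a g J v)"
  have "bad_at a g J v" unfolding v_def using \<open>P J\<close> by (auto simp: P_def intro: LeastI)
  moreover have "\<not> bad_at a g J u" if "u < v" for u using that not_less_Least unfolding v_def by blast
  moreover have "\<not> bad_at a g J' u" if "J < J'" for J' u
    using Greatest_le_nat[of P J' "b 0"] bound that unfolding J_def P_def by force
  ultimately have "last_bad_at a g (J, v)" by (simp add: last_bad_at_def)
  thus ?thesis by blast
qed

text \<open>\<open>C i\<close> counts the entries below \<open>i\<close> in column \<open>J\<close>.
  Going from \<open>J + 1\<close>, which is not bad, to \<open>J\<close> changes the excess by
  \<open>C (v + 2) + C v - 2 * C (v + 1)\<close>, which is at most \<open>1\<close> by column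
  strictness. So the excess is exactly \<open>1\<close>, and column \<open>J\<close> contains no
  \<open>v\<close>.\<close>

lemma last_bad_atD:
  assumes g: "g \<in> bounded_patterns N b" and a: "\<And>r. r \<ge> N \<Longrightarrow> a r = 0" and bad: "last_bad_at a g (J, v)"
  shows "Suc v < N" "J < g (Suc v) r \<Longrightarrow> J < g v r"
    "a (Suc v) + tail_size J g (Suc (Suc v)) + tail_size J g v = Suc (a v + 2 * tail_size J g (Suc v))"
proof -
  have g': "g \<in> patterns b" using g by (simp add: bounded_patterns_def)
  have bad_at: "bad_at a g J v" and not_bad: "\<not> bad_at a g (Suc J) v" 
    using bad by (auto simp: last_bad_at_def)
  show "Suc v < N"
  proof (rule ccontr)
    assume "\<not> Suc v < N"
    hence "g (Suc (Suc v)) = g (Suc v)" "a (Suc v) = 0" using g a by (auto simp: bounded_patterns_def)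
    moreover have "tail_size J g v \<le> tail_size J g (Suc v)" by (rule tail_size_mono[OF g']) simp
    moreover have "tail_size J g (Suc (Suc v)) = tail_size J g (Suc v)"
      using tail_size_eq[OF g', of "Suc v" "Suc (Suc v)" J] calculation(1) by (simp add: tail_size_def)
    ultimately show False using bad_at by (simp add: bad_at_def)
  qed
  define R where "R = Suc (Suc v)"
  define C where "C i = (\<Sum>s<R. of_bool (J < g i s) :: nat)" for i
  have C: "tail_size J g i = tail_size (Suc J) g i + C i" if "i \<le> R" for i
    unfolding tail_size_eq[OF g' that] C_def sum.distrib[symmetric] by (intro sum.cong) auto
  have C1: "C v \<le> C (Suc v)"
    unfolding C_def using patternsD(3)[OF g', of v] by (intro sum_mono) (auto intro: less_le_trans)
  have C2: "C (Suc (Suc v)) \<le> Suc (C (Suc v))"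
  proof -
    have "C (Suc (Suc v)) \<le> Suc (\<Sum>s<Suc v. of_bool (J < g (Suc (Suc v)) (Suc s)))"
      unfolding C_def R_def by (subst sum.lessThan_Suc_shift) simp
    also have "(\<Sum>s<Suc v. of_bool (J < g (Suc (Suc v)) (Suc s))) \<le> (\<Sum>s<Suc v. of_bool (J < g (Suc v) s) :: nat)"
      using patternsD(2)[OF g', of "Suc v"] by (intro sum_mono) (auto intro: less_le_trans)
    also have "\<dots> \<le> C (Suc v)" unfolding C_def R_def by simp
    finally show ?thesis by simp
  qed
  from bad_at not_bad C[of v] C[of "Suc v"] C[of "Suc (Suc v)"] C1 C2
  have eqs: "C v = C (Suc v)" and
    "a (Suc v) + tail_size J g (Suc (Suc v)) + tail_size J g v = Suc (a v + 2 * tail_size J g (Suc v))"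
    unfolding bad_at_def R_def by auto
  thus "a (Suc v) + tail_size J g (Suc (Suc v)) + tail_size J g v = Suc (a v + 2 * tail_size J g (Suc v))"
    by simp
  assume r: "J < g (Suc v) r"
  hence "r < R" using patterns_eq_0[OF g', of "Suc v" r] by (cases "r < R") (auto simp: R_def)
  have "of_bool (J < g v r) = (of_bool (J < g (Suc v) r) :: nat)"
    by (rule sum_mono_inv[OF eqs[unfolded C_def]])
      (use \<open>r < R\<close> patternsD(3)[OF g', of v] in \<open>auto intro: less_le_trans\<close>)
  thus "J < g v r" using r by (simp add: of_bool_def split: if_splits)
qed

definition staircase :: "nat \<Rightarrow> nat \<Rightarrow> nat" where "staircase N i = N - Suc i"

text \<open>Toggling keeps all tails from column \<open>J\<close> on, so the same position is found
  again and the map is an involution. The excess \<open>1\<close> equals the drop of the staircase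
  from \<open>v\<close> to \<open>v + 1\<close>; hence the two exponents are swapped exactly and the
  alternant changes sign.\<close>

lemma sum_bad_alternants:
  assumes b: "shape b" and a: "antimono a" "\<And>r. r \<ge> N \<Longrightarrow> a r = 0"
  shows "(\<Sum>g | g \<in> bounded_patterns N b \<and> \<not> dominant a g. alternant N (\<lambda>i. a i + weight g i + staircase N i)) = 0"
proof -
  let ?B = "{g \<in> bounded_patterns N b. \<not> dominant a g}"
  let ?f = "\<lambda>g. alternant N (\<lambda>i. a i + weight g i + staircase N i)"
  define pos where "pos g = (SOME x. last_bad_at a g x)" for g
  define flip where "flip g = (case pos g of (J, v) \<Rightarrow> toggle J v g)" for g
  have flip: "flip g \<in> ?B \<and> flip (flip g) = g \<and> ?f (flip g) = - ?f g" if "g \<in> ?B" for g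
  proof -
    from that have g: "g \<in> bounded_patterns N b" and bad: "\<not> dominant a g" by auto
    from g have g': "g \<in> patterns b" by (simp add: bounded_patterns_def)
    obtain J v where Jv: "pos g = (J, v)" by (cases "pos g")
    have last: "last_bad_at a g (J, v)"
      using someI_ex[OF ex_last_bad_at[OF g' b a(1) bad]] Jv by (simp add: pos_def)
    note D = last_bad_atD[OF g a(2) last]
    let ?h = "toggle J v g"
    have h: "flip g = ?h" by (simp add: flip_def Jv)
    have "bad_at a ?h J' u \<longleftrightarrow> bad_at a g J' u" if "J \<le> J'" for J' u
      unfolding bad_at_def using tail_size_toggle_ge[OF g' D(2) that] by simp
    hence last': "last_bad_at a ?h (J, v)" using last by (simp add: last_bad_at_def)
    have "last_bad_at a ?h (pos ?h)" unfolding pos_def by (rule someI[of "last_bad_at a ?h", OF last'])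
    from last_bad_at_unique[OF this last'] have "pos ?h = (J, v)" .
    hence "flip ?h = g" using toggle_toggle[OF g' D(2)] by (simp add: flip_def)
    moreover have "?h \<in> ?B"
      using last' toggle_bounded_patterns[OF g D(1,2)] by (auto simp: last_bad_at_def dominant_iff)
    moreover have "?f ?h = - ?f g"
    proof -
      let ?e = "\<lambda>i. a i + weight g i + staircase N i"
      have "a i + weight ?h i + staircase N i = (?e \<circ> Transposition.transpose v (Suc v)) i" for i
      proof -
        consider "i = v" | "i = Suc v" | "i \<noteq> v" "i \<noteq> Suc v" by blast
        thus ?thesis
        proof cases
          case 1
          thus ?thesis using weight_toggle(1)[OF g D(1,2)] D(1,3) by (simp add: staircase_def)
        next
          case 2
          thus ?thesis using weight_toggle(2)[OF g D(1,2)] D(1,3) by (simp add: staircase_def)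
        next
          case 3
          thus ?thesis using weight_toggle(3)[OF g D(1,2)] by (simp add: Transposition.transpose_def)
        qed
      qed
      hence "?f ?h = alternant N (?e \<circ> Transposition.transpose v (Suc v))" by (intro alternant_cong)
      also have "\<dots> = - ?f g" using D(1) by (intro alternant_transpose) auto
      finally show ?thesis .
    qed
    ultimately show ?thesis using h by simp
  qed
  have "sum ?f ?B = (\<Sum>g\<in>?B. - ?f g)"
  proof (rule sum.reindex_bij_witness[of _ flip flip])
    fix g assume "g \<in> ?B"
    from flip[OF this] show "flip (flip g) = g" "flip (flip g) = g" "flip g \<in> ?B" "flip g \<in> ?B" "- ?f (flip g) = ?f g"
      by (simp_all only: minus_minus)
  qed
  hence *: "sum ?f ?B = - sum ?f ?B" by (simp add: sum_negf)
  show ?thesis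
  proof (rule poly_mapping_eqI)
    fix m
    show "Poly_Mapping.lookup (sum ?f ?B) m = Poly_Mapping.lookup 0 m"
      using arg_cong[OF *, of "\<lambda>p. Poly_Mapping.lookup p m"] by simp
  qed
qed

section \<open>Products of Schur polynomials\<close>

lemma alternant_mult_schur_poly_dominant:
  assumes b: "shape b" and a: "antimono a" "\<And>r. r \<ge> N \<Longrightarrow> a r = 0"
  shows "alternant N (\<lambda>i. a i + staircase N i) * schur_poly N b =
    (\<Sum>g | g \<in> bounded_patterns N b \<and> dominant a g. alternant N (\<lambda>i. a i + weight g i + staircase N i))"
proof -
  let ?f = "\<lambda>g. alternant N (\<lambda>i. a i + weight g i + staircase N i)"
  let ?G = "{g. g \<in> bounded_patterns N b \<and> dominant a g}" and ?B = "{g. g \<in> bounded_patterns N b \<and> \<not> dominant a g}"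
  have "alternant N (\<lambda>i. a i + staircase N i) * schur_poly N b = sum ?f (bounded_patterns N b)"
    unfolding alternant_mult_schur_poly[OF b] by (intro sum.cong alternant_cong) auto
  moreover have "?G \<union> ?B = bounded_patterns N b" by blast
  moreover have "finite ?G" "finite ?B" using finite_bounded_patterns[OF b, of N] by (auto intro: finite_subset)
  hence "sum ?f (?G \<union> ?B) = sum ?f ?G + sum ?f ?B" by (intro sum.union_disjoint) auto
  moreover have "sum ?f ?B = 0" by (rule sum_bad_alternants[OF assms])
  ultimately show ?thesis by (simp only: add_0_right)
qed

text \<open>Row \<open>r\<close> has no entry above \<open>r\<close> by
  \<open>dominant_stable\<close> with \<open>L = 0\<close>, and none below \<open>r\<close> by
  column strictness.\<close>

lemma bounded_patterns_dominant_0: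
  assumes b: "shape b" "\<And>r. r \<ge> N \<Longrightarrow> b r = 0"
  shows "{g. g \<in> bounded_patterns N b \<and> dominant (\<lambda>_. 0) g} = {\<lambda>i r. if r < i then b r else 0}" (is "_ = {?g0}")
proof -
  have "g = ?g0" if "g \<in> bounded_patterns N b" "dominant (\<lambda>_. 0) g" for g
  proof (intro ext)
    fix i r
    show "g i r = ?g0 i r"
      using dominant_stable[of g b "\<lambda>_. 0" 0 r i] patterns_eq_0[of g b i r] that by (auto simp: bounded_patterns_def)
  qed
  moreover have "?g0 \<in> bounded_patterns N b"
  proof -
    have "(\<lambda>r. if r < i then b r else 0) = b" if "i \<ge> N" for i using b(2) that by (simp add: fun_eq_iff not_less)
    moreover have "b (Suc r) \<le> b r" for r using b by (simp add: shape_def antimono_iff_le_Suc)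
    ultimately show ?thesis unfolding bounded_patterns_def patterns_def by simp blast
  qed
  moreover have "dominant (\<lambda>_. 0) ?g0"
  proof -
    have "b (Suc v) - J \<le> b v - J" for v J
      using b by (intro diff_le_mono) (simp add: shape_def antimono_iff_le_Suc)
    thus ?thesis by (simp add: dominant_def tail_size_def)
  qed
  ultimately show ?thesis by blast
qed

text \<open>The bialternant formula: for \<open>a = 0\<close> the only dominant tableau has weight
  \<open>b\<close>.\<close>

lemma alternant_staircase_mult_schur_poly:
  assumes b: "shape b" "\<And>r. r \<ge> N \<Longrightarrow> b r = 0"
  shows "alternant N (staircase N) * schur_poly N b = alternant N (\<lambda>i. b i + staircase N i)"
proof -
  have "weight (\<lambda>i r. if r < i then b r else 0) = b"
    by (auto simp: fun_eq_iff weight_def tail_size_def)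
  with alternant_mult_schur_poly_dominant[OF b(1), of "\<lambda>_. 0" N] bounded_patterns_dominant_0[OF b]
  show ?thesis by (simp add: antimono_def)
qed

text \<open>The staircase has distinct values, so its own monomial arises from the identity
  permutation only.\<close>

lemma alternant_staircase_neq_0: "alternant N (staircase N) \<noteq> 0"
proof -
  have "p = id" if p: "p permutes {..<N}" and eq: "monomial_exp N (staircase N \<circ> p) = monomial_exp N (staircase N)" for p
  proof
    fix i
    show "p i = id i"
    proof (cases "i < N")
      case True
      with p have "p i < N" by (auto dest: permutes_in_image)
      with True arg_cong[OF eq, of "\<lambda>x. Poly_Mapping.lookup x i"] show ?thesis
        by (simp add: lookup_monomial_exp staircase_def)
    qed (use p in \<open>auto simp: permutes_def\<close>)
  qed
  hence "Poly_Mapping.lookup (alternant N (staircase N)) (monomial_exp N (staircase N)) =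
      (\<Sum>p | p permutes {..<N}. if p = id then 1 else 0)"
    unfolding alternant_def lookup_sum lookup_single by (intro sum.cong) (auto simp: when_def)
  also have "\<dots> = 1" by (simp add: finite_permutations permutes_id)
  finally show ?thesis by auto
qed

text \<open>After multiplication by the staircase alternant both sides agree by the bialternant
  formula; this nonzero factor is then cancelled.\<close>

lemma schur_poly_mult:
  assumes a: "shape a" "\<And>r. r \<ge> N \<Longrightarrow> a r = 0" and b: "shape b" "\<And>r. r \<ge> N \<Longrightarrow> b r = 0"
  shows "schur_poly N a * schur_poly N b = (\<Sum>g | g \<in> bounded_patterns N b \<and> dominant a g. schur_poly N (\<lambda>i. a i + weight g i))"
proof -
  have "alternant N (staircase N) * (schur_poly N a * schur_poly N b) =
     (\<Sum>g | g \<in> bounded_patterns N b \<and> dominant a g. alternant N (\<lambda>i. a i + weight g i + staircase N i))"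
    using alternant_staircase_mult_schur_poly[OF a] alternant_mult_schur_poly_dominant[OF b(1) _ a(2)] a(1)
    by (simp add: shape_def mult.assoc[symmetric])
  also have "\<dots> = (\<Sum>g | g \<in> bounded_patterns N b \<and> dominant a g. alternant N (staircase N) * schur_poly N (\<lambda>i. a i + weight g i))"
  proof (intro sum.cong refl alternant_staircase_mult_schur_poly[symmetric])
    fix g assume "g \<in> {g. g \<in> bounded_patterns N b \<and> dominant a g}"
    hence g: "g \<in> bounded_patterns N b" "g \<in> patterns b" "dominant a g" by (auto simp: bounded_patterns_def)
    show "shape (\<lambda>i. a i + weight g i)" by (rule dominant_shape[OF g(3,2) a(1) b(1)])
    fix r assume "N \<le> r"
    hence "g (Suc r) = g r" using g(1) by (simp add: bounded_patterns_def)
    hence "weight g r = 0" using tail_size_eq[OF g(2), of r "Suc r" 0] by (simp add: weight_def tail_size_def)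
    thus "a r + weight g r = 0" using a(2) \<open>N \<le> r\<close> by simp
  qed
  finally have "alternant N (staircase N) * (schur_poly N a * schur_poly N b) =
    alternant N (staircase N) * (\<Sum>g | g \<in> bounded_patterns N b \<and> dominant a g. schur_poly N (\<lambda>i. a i + weight g i))"
    by (simp add: sum_distrib_left)
  thus ?thesis using alternant_staircase_neq_0 by simp
qed

section \<open>Tableaux as patterns, and series as polynomials\<close>

definition row_length :: "nat list \<Rightarrow> nat \<Rightarrow> nat" where
  "row_length lam r = (if r < length lam then lam ! r else 0)"

definition partition_of :: "(nat \<Rightarrow> nat) \<Rightarrow> nat list" where
  "partition_of f = (SOME lam. is_partition lam \<and> row_length lam = f)"

lemma young_diagram_iff: "(r, c) \<in> young_diagram lam \<longleftrightarrow> c < row_length lam r"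
  by (simp add: young_diagram_def row_length_def)

lemma shape_row_length:
  assumes "is_partition lam" shows "shape (row_length lam)"
proof -
  have "row_length lam (Suc r) \<le> row_length lam r" for r
    using assms by (auto simp: row_length_def is_partition_def sorted_wrt_iff_nth_less)
  hence "antimono (row_length lam)" by (simp add: antimono_iff_le_Suc)
  moreover have "\<forall>r\<ge>length lam. row_length lam r = 0" by (simp add: row_length_def)
  ultimately show ?thesis unfolding shape_def by blast
qed

lemma partition_of:
  assumes "shape f"
  shows "is_partition (partition_of f)" "row_length (partition_of f) = f"
proof -
  have f: "antimono f" and ex: "\<exists>L. f L = 0" using assms by (auto simp: shape_def)
  define n where "n = (LEAST n. f n = 0)"
  have n: "f n = 0" unfolding n_def using ex by (auto intro: LeastI)
  have pos: "f i \<noteq> 0" if "i < n" for i using that not_less_Least unfolding n_def by blast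
  have zero: "f i = 0" if "n \<le> i" for i using antimonoD[OF f that] n by simp
  have "0 \<notin> f ` {..<n}" using pos by (metis imageE lessThan_iff)
  hence "is_partition (map f [0..<n])"
    using antimonoD[OF f] by (auto simp: lessThan_atLeast0 is_partition_def sorted_wrt_iff_nth_less)
  moreover have "row_length (map f [0..<n]) = f"
    using zero by (auto simp: row_length_def fun_eq_iff)
  ultimately have "is_partition (partition_of f) \<and> row_length (partition_of f) = f"
    unfolding partition_of_def by (intro someI[of "\<lambda>lam. is_partition lam \<and> row_length lam = f"] conjI)
  thus "is_partition (partition_of f)" "row_length (partition_of f) = f" by auto
qed

definition pattern_of :: "nat list \<Rightarrow> (nat \<times> nat \<Rightarrow> nat) \<Rightarrow> nat \<Rightarrow> nat \<Rightarrow> nat" where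
  "pattern_of lam T i r = card {c. c < row_length lam r \<and> T (r, c) < i}"

lemma ssytD:
  assumes "T \<in> ssyt lam"
  shows "c < c' \<Longrightarrow> c' < row_length lam r \<Longrightarrow> T (r, c) \<le> T (r, c')"
    "r < r' \<Longrightarrow> c < row_length lam r \<Longrightarrow> c < row_length lam r' \<Longrightarrow> T (r, c) < T (r', c)"
    "\<not> c < row_length lam r \<Longrightarrow> T (r, c) = undefined"
  using assms PiE_arb[of T "young_diagram lam" "\<lambda>_. UNIV" "(r, c)"]
  by (simp_all add: ssyt_def young_diagram_iff)

lemma down_closed_eq_lessThan:
  fixes S :: "nat set"
  assumes "finite S" "\<And>c c'. c' \<in> S \<Longrightarrow> c < c' \<Longrightarrow> c \<in> S"
  shows "S = {..<card S}"
  using assms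
proof (induction "card S" arbitrary: S)
  case (Suc n)
  hence ne: "S \<noteq> {}" by auto
  define M where "M = Max S"
  have M: "M \<in> S" unfolding M_def using Suc ne by auto
  have "S = {..M}" using Suc.prems M Max_ge[OF Suc.prems(1)] unfolding M_def by (auto simp: le_less)
  thus ?case by (simp add: lessThan_Suc_atMost)
qed auto

text \<open>Rows increase weakly, so the entries below \<open>i\<close> fill an initial segment of
  the row, and their number determines the boxes.\<close>

lemma less_pattern_of_iff:
  assumes "T \<in> ssyt lam"
  shows "c < pattern_of lam T i r \<longleftrightarrow> c < row_length lam r \<and> T (r, c) < i"
proof -
  have "{c. c < row_length lam r \<and> T (r, c) < i} = {..<pattern_of lam T i r}"
    unfolding pattern_of_def
    by (rule down_closed_eq_lessThan) (use ssytD(1)[OF assms] in \<open>auto intro: le_less_trans\<close>)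
  thus ?thesis by blast
qed

lemma pattern_of_patterns:
  assumes lam: "is_partition lam" and T: "T \<in> ssyt lam"
  shows "pattern_of lam T \<in> patterns (row_length lam)"
proof -
  let ?g = "pattern_of lam T"
  have anti: "row_length lam (Suc r) \<le> row_length lam r" for r
    using shape_row_length[OF lam] by (auto simp: shape_def antimono_iff_le_Suc)
  note iff = less_pattern_of_iff[OF T]
  have le: "x \<le> y" if "\<And>c. c < x \<Longrightarrow> c < y" for x y :: nat
    using that[of y] by (auto simp: not_le[symmetric])
  have "?g 0 r = 0" for r by (simp add: pattern_of_def)
  moreover have "?g (Suc i) (Suc r) \<le> ?g i r" for i r
  proof (rule le)
    fix c assume c: "c < ?g (Suc i) (Suc r)"
    hence "c < row_length lam r" using anti[of r] by (auto simp: iff)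
    with c ssytD(2)[OF T, of r "Suc r" c] show "c < ?g i r" by (auto simp: iff)
  qed
  moreover have "?g i r \<le> ?g (Suc i) r" for i r by (rule le) (auto simp: iff)
  moreover have "\<exists>N. \<forall>i\<ge>N. ?g i = row_length lam"
  proof -
    define N where "N = Suc (\<Sum>b\<in>young_diagram lam. T b)"
    have "T (r, c) < N" if "c < row_length lam r" for r c
      using member_le_sum[of "(r, c)" "young_diagram lam" T] that finite_young_diagram
      by (auto simp: N_def young_diagram_iff)
    hence "?g i r = row_length lam r" if "N \<le> i" for i r
      by (intro antisym le) (use that in \<open>auto simp: iff intro: less_le_trans\<close>)
    thus ?thesis by blast
  qed
  ultimately show ?thesis by (simp add: patterns_def)
qed

lemma bij_betw_pattern_of:
  assumes lam: "is_partition lam"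
  shows "bij_betw (pattern_of lam) (ssyt lam) (patterns (row_length lam))"
proof (rule bij_betwI')
  fix T T' assume T: "T \<in> ssyt lam" "T' \<in> ssyt lam"
  show "pattern_of lam T = pattern_of lam T' \<longleftrightarrow> T = T'"
  proof
    assume eq: "pattern_of lam T = pattern_of lam T'"
    show "T = T'"
    proof (rule ext, clarify)
      fix r c
      show "T (r, c) = T' (r, c)"
      proof (cases "c < row_length lam r")
        case True
        hence "T (r, c) < i \<longleftrightarrow> T' (r, c) < i" for i
          using less_pattern_of_iff[OF T(1), of c i r] less_pattern_of_iff[OF T(2), of c i r] eq by simp
        from this[of "T (r, c)"] this[of "T' (r, c)"] show ?thesis by simp
      qed (use ssytD(3)[OF T(1)] ssytD(3)[OF T(2)] in auto)
    qed
  qed simp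
next
  fix T assume "T \<in> ssyt lam"
  thus "pattern_of lam T \<in> patterns (row_length lam)" by (rule pattern_of_patterns[OF lam])
next
  fix g assume g: "g \<in> patterns (row_length lam)"
  \<comment> \<open>The inverse map: a box gets entry \<open>i\<close> if level \<open>i + 1\<close>
    is the first to reach it. The value \<open>undefined\<close> outside the diagram is forced by
    extensionality.\<close>
  define T where "T = (\<lambda>(r, c). if c < row_length lam r then LEAST i. c < g (Suc i) r else undefined)"
  obtain N where N: "\<And>i. i \<ge> N \<Longrightarrow> g i = row_length lam" using g by (auto simp: patterns_def)
  have T_less: "T (r, c) < i \<longleftrightarrow> c < g i r" if c: "c < row_length lam r" for r c i
  proof
    assume less: "T (r, c) < i"
    have "c < g (Suc (LEAST i. c < g (Suc i) r)) r"
      using N[of "Suc N"] c by (intro LeastI[of "\<lambda>i. c < g (Suc i) r" N]) simp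
    hence "c < g (Suc (T (r, c))) r" using c by (simp add: T_def)
    also have "\<dots> \<le> g i r" by (rule patterns_mono[OF g]) (use less in simp)
    finally show "c < g i r" .
  next
    assume less: "c < g i r"
    then obtain i' where i: "i = Suc i'" using patternsD(1)[OF g, of r] by (cases i) auto
    show "T (r, c) < i" using less c Least_le[of "\<lambda>i. c < g (Suc i) r" i'] by (simp add: T_def i)
  qed
  have "T \<in> ssyt lam"
    unfolding ssyt_def
  proof (intro CollectI conjI allI impI)
    show "T \<in> young_diagram lam \<rightarrow>\<^sub>E UNIV"
      by (auto simp: T_def young_diagram_iff)
  next
    fix r c c' :: nat
    assume "c < c'" and c: "(r, c) \<in> young_diagram lam" "(r, c') \<in> young_diagram lam"
    hence "T (r, c) < Suc (T (r, c'))"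
      using T_less[of c' r "Suc (T (r, c'))"] T_less[of c r "Suc (T (r, c'))"] by (simp add: young_diagram_iff)
    thus "T (r, c) \<le> T (r, c')" by simp
  next
    fix r r' c :: nat
    assume "r < r'" and c: "(r, c) \<in> young_diagram lam" "(r', c) \<in> young_diagram lam"
    then obtain r'' where r'': "r' = Suc r''" "r \<le> r''" by (cases r') auto
    have "c < g (Suc (T (r', c))) r'"
      using T_less[of c r' "Suc (T (r', c))"] c by (simp add: young_diagram_iff)
    also have "\<dots> \<le> g (T (r', c)) r''" unfolding r'' by (rule patternsD(2)[OF g])
    also have "\<dots> \<le> g (T (r', c)) r" by (rule patterns_antimono[OF g r''(2)])
    finally show "T (r, c) < T (r', c)" using T_less[of c r "T (r', c)"] c by (simp add: young_diagram_iff)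
  qed
  moreover have "pattern_of lam T i r = g i r" for i r
  proof -
    have "{c. c < row_length lam r \<and> T (r, c) < i} = {..<g i r}"
      using T_less patterns_le[OF g, of i r] by (auto intro: less_le_trans)
    thus ?thesis by (simp add: pattern_of_def)
  qed
  ultimately show "\<exists>T\<in>ssyt lam. g = pattern_of lam T" by (intro bexI[of _ T] ext) auto
qed

lemma lookup_content:
  assumes lam: "is_partition lam" and T: "T \<in> ssyt lam"
  shows "Poly_Mapping.lookup (content lam T) v = weight (pattern_of lam T) v"
proof -
  let ?g = "pattern_of lam T"
  define R where "R = Suc v + length lam"
  have yd: "young_diagram lam = Sigma {..<R} (\<lambda>r. {..<row_length lam r})"
    by (auto simp: young_diagram_iff R_def) (auto simp: row_length_def split: if_splits)
  have "Poly_Mapping.lookup (content lam T) v = (\<Sum>b\<in>young_diagram lam. of_bool (T b = v))"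
    unfolding content_def lookup_sum lookup_single by (intro sum.cong refl) (simp add: when_def)
  also have "\<dots> = (\<Sum>r<R. \<Sum>c<row_length lam r. of_bool (T (r, c) = v))"
    unfolding yd by (subst sum.Sigma) auto
  also have "\<dots> = (\<Sum>r<R. card {c. c < row_length lam r \<and> T (r, c) = v})"
    by (intro sum.cong refl) (simp add: sum.If_cases of_bool_def Int_def)
  finally have "Poly_Mapping.lookup (content lam T) v + (\<Sum>r<R. ?g v r) =
      (\<Sum>r<R. card {c. c < row_length lam r \<and> T (r, c) = v} + ?g v r)"
    by (simp add: sum.distrib)
  also have "\<dots> = (\<Sum>r<R. ?g (Suc v) r)"
  proof (intro sum.cong refl)
    fix r
    have "{c. c < row_length lam r \<and> T (r, c) < Suc v} =
      {c. c < row_length lam r \<and> T (r, c) = v} \<union> {c. c < row_length lam r \<and> T (r, c) < v}" by auto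
    thus "card {c. c < row_length lam r \<and> T (r, c) = v} + ?g v r = ?g (Suc v) r"
      unfolding pattern_of_def by (simp add: card_Un_disjoint disjoint_iff)
  qed
  finally show ?thesis
    using weight_add[OF pattern_of_patterns[OF lam T], of v]
      tail_size_eq[OF pattern_of_patterns[OF lam T], of v R 0] tail_size_eq[OF pattern_of_patterns[OF lam T], of "Suc v" R 0]
    by (simp add: R_def)
qed

lemma bounded_patterns_iff_weight:
  assumes g: "g \<in> patterns b"
  shows "g \<in> bounded_patterns N b \<longleftrightarrow> (\<forall>v\<ge>N. weight g v = 0)"
proof
  assume "g \<in> bounded_patterns N b"
  hence eq: "g i = b" if "N \<le> i" for i using that by (simp add: bounded_patterns_def)
  show "\<forall>v\<ge>N. weight g v = 0"
  proof (intro allI impI)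
    fix v assume "N \<le> v"
    thus "weight g v = 0"
      using eq[of v] eq[of "Suc v"] tail_size_eq[OF g, of v "Suc v" 0] by (simp add: weight_def tail_size_def)
  qed
next
  assume weight: "\<forall>v\<ge>N. weight g v = 0"
  obtain N' where N': "\<And>i. i \<ge> N' \<Longrightarrow> g i = b" using g by (auto simp: patterns_def)
  have "g (i + n) = g i" if "N \<le> i" for i n
  proof (induction n)
    case (Suc n)
    thus ?case using weight_eq_0D[OF g, of "i + n"] weight that by (auto simp: fun_eq_iff)
  qed simp
  from this[of _ N'] N' have "g i = b" if "N \<le> i" for i using that by (metis le_add2)
  thus "g \<in> bounded_patterns N b" using g by (simp add: bounded_patterns_def)
qed

text \<open>A monomial in the variables below \<open>N\<close> sees only tableaux with entries below
  \<open>N\<close>, so each coefficient can be computed in finitely many variables.\<close>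

lemma coeff_of_schur:
  assumes lam: "is_partition lam" and m: "\<And>i. i \<ge> N \<Longrightarrow> Poly_Mapping.lookup m i = 0"
  shows "coeff_of (schur lam) m = Poly_Mapping.lookup (schur_poly N (row_length lam)) m"
proof -
  let ?b = "row_length lam"
  have "bij_betw (pattern_of lam) {T \<in> ssyt lam. content lam T = m} {g \<in> patterns ?b. weight g = Poly_Mapping.lookup m}"
    by (rule bij_betw_Collect[OF bij_betw_pattern_of[OF lam]])
      (auto simp: lookup_content[OF lam, symmetric] fun_eq_iff poly_mapping_eq_iff)
  hence "card {T \<in> ssyt lam. content lam T = m} = card {g \<in> patterns ?b. weight g = Poly_Mapping.lookup m}"
    by (rule bij_betw_same_card)
  also have "{g \<in> patterns ?b. weight g = Poly_Mapping.lookup m} = {g \<in> bounded_patterns N ?b. m = monomial_exp N (weight g)}"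
  proof (intro Collect_cong)
    fix g
    have "weight g = Poly_Mapping.lookup m \<longleftrightarrow> (\<forall>v\<ge>N. weight g v = 0) \<and> monomial_exp N (weight g) = m"
      using m by (auto simp: poly_mapping_eq_iff fun_eq_iff lookup_monomial_exp) (metis not_le)+
    thus "g \<in> patterns ?b \<and> weight g = Poly_Mapping.lookup m \<longleftrightarrow> g \<in> bounded_patterns N ?b \<and> m = monomial_exp N (weight g)"
      using bounded_patterns_iff_weight[of g ?b N] by (auto simp: bounded_patterns_def)
  qed
  finally show ?thesis
    using finite_bounded_patterns[OF shape_row_length[OF lam], of N]
    by (simp add: schur_def schur_poly_def lookup_sum lookup_single when_def sum.If_cases Int_def)
qed

lemma lookup_mult_splittings:
  fixes p q :: "(nat \<Rightarrow>\<^sub>0 nat) \<Rightarrow>\<^sub>0 int"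
  shows "Poly_Mapping.lookup (p * q) m =
    (\<Sum>(x, y)\<in>{(x, y). x + y = m}. Poly_Mapping.lookup p x * Poly_Mapping.lookup q y)"
proof -
  have "Poly_Mapping.lookup (p * q) m =
      (\<Sum>(x, y). Poly_Mapping.lookup p x * Poly_Mapping.lookup q y when m = x + y)"
    by (simp add: times_poly_mapping.rep_eq prod_fun_unfold_prod)
  also have "\<dots> = (\<Sum>(x, y)\<in>{(x, y). x + y = m}. Poly_Mapping.lookup p x * Poly_Mapping.lookup q y when m = x + y)"
    by (rule Sum_any.expand_superset[OF finite_splittings]) (auto simp: when_def split: if_splits)
  finally show ?thesis by (auto simp: when_def case_prod_unfold intro!: sum.cong)
qed

lemma coeff_of_sum: "coeff_of (\<Sum>x\<in>X. f x) m = (\<Sum>x\<in>X. coeff_of (f x) m)"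
  by (induction X rule: infinite_finite_induct) (auto simp: zero_power_series_def plus_power_series_def)

theorem schur_mult:
  assumes lam: "is_partition lam" and mu: "is_partition mu"
  shows "schur lam * schur mu =
    (\<Sum>g\<in>LR_patterns (row_length lam) (row_length mu). schur (partition_of (\<lambda>i. row_length lam i + weight g i)))"
    (is "_ = sum ?s _")
proof -
  let ?a = "row_length lam" and ?b = "row_length mu"
  have "coeff_of (schur lam * schur mu) m = coeff_of (\<Sum>g\<in>LR_patterns ?a ?b. ?s g) m" for m
  proof -
    \<comment> \<open>\<open>N\<close> depends on the monomial, but the set of dominant tableaux
      does not depend on \<open>N\<close>; so one expansion serves all coefficients.\<close>
    define N where "N = length lam + length mu + Suc (Max (insert 0 (Poly_Mapping.keys m)))"
    have m: "Poly_Mapping.lookup m i = 0" if "N \<le> i" for i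
    proof (rule ccontr)
      assume "Poly_Mapping.lookup m i \<noteq> 0"
      hence "i \<le> Max (insert 0 (Poly_Mapping.keys m))" by (intro Max_ge) (auto simp: in_keys_iff)
      thus False using that by (simp add: N_def)
    qed
    have a0: "?a r = 0" if "N \<le> r" for r using that by (simp add: row_length_def N_def)
    have b0: "?b r = 0" if "N \<le> r" for r using that by (simp add: row_length_def N_def)
    have LR_patterns: "LR_patterns ?a ?b = {g. g \<in> bounded_patterns N ?b \<and> dominant ?a g}"
      by (rule LR_patterns_subset_bounded_patterns[of "length lam" _ "length mu"]) (auto simp: row_length_def N_def)
    have "coeff_of (schur lam * schur mu) m =
        (\<Sum>(x, y)\<in>{(x, y). x + y = m}. coeff_of (schur lam) x * coeff_of (schur mu) y)"
      by (simp add: times_power_series_def)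
    also have "\<dots> = (\<Sum>(x, y)\<in>{(x, y). x + y = m}.
        Poly_Mapping.lookup (schur_poly N ?a) x * Poly_Mapping.lookup (schur_poly N ?b) y)"
    proof (intro sum.cong refl, clarify)
      fix x y assume "m = x + y"
      hence "Poly_Mapping.lookup x i = 0" "Poly_Mapping.lookup y i = 0" if "N \<le> i" for i
        using m[OF that] by (auto simp: lookup_add)
      thus "coeff_of (schur lam) x * coeff_of (schur mu) y =
          Poly_Mapping.lookup (schur_poly N ?a) x * Poly_Mapping.lookup (schur_poly N ?b) y"
        using coeff_of_schur[OF lam, of N x] coeff_of_schur[OF mu, of N y] by simp
    qed
    also have "\<dots> = Poly_Mapping.lookup (schur_poly N ?a * schur_poly N ?b) m"
      by (rule lookup_mult_splittings[symmetric])
    also have "\<dots> = (\<Sum>g\<in>LR_patterns ?a ?b. Poly_Mapping.lookup (schur_poly N (\<lambda>i. ?a i + weight g i)) m)"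
      unfolding LR_patterns
      by (subst schur_poly_mult[OF shape_row_length[OF lam] a0 shape_row_length[OF mu] b0]) (auto simp: lookup_sum)
    also have "\<dots> = (\<Sum>g\<in>LR_patterns ?a ?b. coeff_of (?s g) m)"
    proof (intro sum.cong refl)
      fix g assume "g \<in> LR_patterns ?a ?b"
      hence "shape (\<lambda>i. ?a i + weight g i)"
        using dominant_shape[OF _ _ shape_row_length[OF lam] shape_row_length[OF mu]] by (simp add: LR_patterns_def)
      note part = partition_of[OF this]
      show "Poly_Mapping.lookup (schur_poly N (\<lambda>i. ?a i + weight g i)) m = coeff_of (?s g) m"
        using coeff_of_schur[OF part(1) m] part(2) by simp
    qed
    finally show ?thesis by (simp add: coeff_of_sum)
  qed
  thus ?thesis by (simp add: coeff_of_inject')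
qed

section \<open>Moving boxes between two shapes\<close>

text \<open>The injection preserves the final partition \<open>a + weight g\<close>, so it compares
  Littlewood-Richardson coefficients one \<open>nu\<close> at a time.\<close>

definition LR_embeds :: "(nat \<Rightarrow> nat) \<Rightarrow> (nat \<Rightarrow> nat) \<Rightarrow> (nat \<Rightarrow> nat) \<Rightarrow> (nat \<Rightarrow> nat) \<Rightarrow> bool" where
  "LR_embeds a b a' b' \<longleftrightarrow> (\<exists>\<phi>. inj_on \<phi> (LR_patterns a b) \<and>
     (\<forall>g\<in>LR_patterns a b. \<phi> g \<in> LR_patterns a' b' \<and> (\<forall>i. a' i + weight (\<phi> g) i = a i + weight g i)))"

lemma LR_embeds_refl: "LR_embeds a b a b"
  unfolding LR_embeds_def by (intro exI[of _ "\<lambda>g. g"]) auto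

lemma LR_embeds_trans:
  assumes "LR_embeds a b a' b'" "LR_embeds a' b' a'' b''" shows "LR_embeds a b a'' b''"
proof -
  from assms obtain \<phi> \<psi> where 
    "inj_on \<phi> (LR_patterns a b)" "\<And>g. g \<in> LR_patterns a b \<Longrightarrow> \<phi> g \<in> LR_patterns a' b'" "\<And>g i. g \<in> LR_patterns a b \<Longrightarrow> a' i + weight (\<phi> g) i = a i + weight g i"
    "inj_on \<psi> (LR_patterns a' b')" "\<And>g. g \<in> LR_patterns a' b' \<Longrightarrow> \<psi> g \<in> LR_patterns a'' b''" "\<And>g i. g \<in> LR_patterns a' b' \<Longrightarrow> a'' i + weight (\<psi> g) i = a' i + weight g i"
    unfolding LR_embeds_def by blast
  thus ?thesis
    unfolding LR_embeds_def by (intro exI[of _ "\<lambda>g. \<psi> (\<phi> g)"]) (simp add: inj_on_def)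
qed

lemma schur_positive_sum:
  assumes "finite X" "\<And>x. x \<in> X \<Longrightarrow> is_partition (f x)"
  shows "schur_positive (\<Sum>x\<in>X. schur (f x))"
  unfolding schur_positive_def
proof (intro exI[of _ "f ` X"] exI[of _ "\<lambda>mu. int (card {x \<in> X. f x = mu})"] conjI)
  have "(\<Sum>x\<in>X. schur (f x)) = (\<Sum>mu\<in>f ` X. \<Sum>x | x \<in> X \<and> f x = mu. schur (f x))"
    by (rule sum.image_gen[OF assms(1)])
  also have "\<dots> = (\<Sum>mu\<in>f ` X. of_int (int (card {x \<in> X. f x = mu})) * schur mu)"
    by (intro sum.cong refl) simp
  finally show "(\<Sum>x\<in>X. schur (f x)) = (\<Sum>mu\<in>f ` X. of_int (int (card {x \<in> X. f x = mu})) * schur mu)" .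
qed (use assms in auto)

lemma schur_positive_if_LR_embeds:
  assumes lam: "is_partition lam" and mu: "is_partition mu" and lam': "is_partition lam'" and mu': "is_partition mu'"
    and emb: "LR_embeds (row_length lam) (row_length mu) (row_length lam') (row_length mu')"
  shows "schur_positive (schur lam' * schur mu' - schur lam * schur mu)"
proof -
  let ?a = "row_length lam" and ?b = "row_length mu" and ?a' = "row_length lam'" and ?b' = "row_length mu'"
  let ?s = "\<lambda>g. partition_of (\<lambda>i. ?a' i + weight g i)"
  obtain \<phi> where inj: "inj_on \<phi> (LR_patterns ?a ?b)" and \<phi>: "\<phi> ` LR_patterns ?a ?b \<subseteq> LR_patterns ?a' ?b'"
    and weight: "\<And>g i. g \<in> LR_patterns ?a ?b \<Longrightarrow> ?a' i + weight (\<phi> g) i = ?a i + weight g i"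
    using emb unfolding LR_embeds_def by blast
  have fin: "finite (LR_patterns ?a' ?b')" by (intro finite_LR_patterns shape_row_length lam' mu')
  have "(\<Sum>g\<in>\<phi> ` LR_patterns ?a ?b. schur (?s g)) = schur lam * schur mu"
    unfolding schur_mult[OF lam mu] sum.reindex[OF inj] by (intro sum.cong refl) (simp add: weight)
  hence "schur lam' * schur mu' - schur lam * schur mu = (\<Sum>g\<in>LR_patterns ?a' ?b' - \<phi> ` LR_patterns ?a ?b. schur (?s g))"
    unfolding schur_mult[OF lam' mu'] using sum_diff[OF fin \<phi>, of "\<lambda>g. schur (?s g)"] by simp
  moreover have "is_partition (?s g)" if "g \<in> LR_patterns ?a' ?b'" for g
    using that dominant_shape[OF _ _ shape_row_length[OF lam'] shape_row_length[OF mu']]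
    by (intro partition_of) (auto simp: LR_patterns_def)
  ultimately show ?thesis using fin by (auto intro!: schur_positive_sum)
qed

text \<open>The \<open>k\<close> new boxes hold the entry \<open>0\<close> and make up for the loss
  in \<open>a 0\<close>. Prepending them shifts columns, whereas the row-wise condition changes by
  constants only.\<close>

lemma LR_embeds_first_row:
  assumes a: "antimono a" and le: "a (Suc 0) + b 0 + k \<le> a 0"
  shows "LR_embeds a b (a(0 := a 0 - k)) (b(0 := b 0 + k))"
proof -
  let ?a = "a(0 := a 0 - k)" and ?b = "b(0 := b 0 + k)"
  define \<phi> where "\<phi> g i r = g i r + (if r = 0 \<and> 0 < i then k else 0)" for g :: "nat \<Rightarrow> nat \<Rightarrow> nat" and i r :: nat
  have "\<phi> g \<in> LR_patterns ?a ?b \<and> (\<forall>i. ?a i + weight (\<phi> g) i = a i + weight g i)" if "g \<in> LR_patterns a b" for g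
  proof -
    from that have g: "g \<in> patterns b" and dominant: "dominant a g" by (auto simp: LR_patterns_def)
    obtain N where N: "\<And>i. i \<ge> N \<Longrightarrow> g i = b" using g by (auto simp: patterns_def)
    have "\<forall>i\<ge>Suc N. \<phi> g i = ?b" using N by (auto simp: \<phi>_def fun_eq_iff)
    moreover have "\<phi> g 0 r = 0" for r using patternsD(1)[OF g] by (simp add: \<phi>_def)
    moreover have "\<phi> g (Suc i) (Suc r) \<le> \<phi> g i r" for i r
      using patternsD(2)[OF g, of i r] by (simp add: \<phi>_def)
    moreover have "\<phi> g i r \<le> \<phi> g (Suc i) r" for i r
      using patternsD(3)[OF g, of i r] by (auto simp: \<phi>_def)
    ultimately have h: "\<phi> g \<in> patterns ?b" unfolding patterns_def by blast
    have tail: "tail_size 0 (\<phi> g) i = tail_size 0 g i + (if 0 < i then k else 0)" for i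
    proof -
      have "(\<Sum>r<i. if r = 0 \<and> 0 < i then k else 0) = (\<Sum>r<i. if r = 0 then k else 0)"
        by (intro sum.cong) auto
      thus ?thesis by (simp add: tail_size_def \<phi>_def sum.distrib)
    qed
    have "weight (\<phi> g) i = weight g i + (if i = 0 then k else 0)" for i
      using weight_add[OF g, of i] weight_add[OF h, of i] tail[of i] tail[of "Suc i"] by (auto split: if_splits)
    hence weight: "\<forall>i. ?a i + weight (\<phi> g) i = a i + weight g i" using le by simp
    have anti: "antimono ?a"
      using a le by (auto simp: antimono_iff_le_Suc)
    have row: "row_dominant ?a (\<phi> g)"
      unfolding row_dominant_def
    proof (intro allI)
      fix v r
      have s1: "(\<Sum>s\<le>r. \<phi> g (Suc i) s) = (\<Sum>s\<le>r. g (Suc i) s) + k" for i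
        by (simp add: \<phi>_def sum.distrib)
      have s2: "(\<Sum>s<r. \<phi> g i s) = (\<Sum>s<r. g i s) + (if 0 < r \<and> 0 < i then k else 0)" for i
        by (cases "0 < i") (simp_all add: \<phi>_def sum.distrib)
      have old: "a (Suc v) + (\<Sum>s\<le>r. g (Suc (Suc v)) s) + (\<Sum>s<r. g v s)
          \<le> a v + (\<Sum>s\<le>r. g (Suc v) s) + (\<Sum>s<r. g (Suc v) s)"
        using dominant_imp_row_dominant[OF g dominant] unfolding row_dominant_def by blast
      consider "v = 0" "r = 0" | "v = 0" "0 < r" | "0 < v" by blast
      thus "?a (Suc v) + (\<Sum>s\<le>r. \<phi> g (Suc (Suc v)) s) + (\<Sum>s<r. \<phi> g v s)
          \<le> ?a v + (\<Sum>s\<le>r. \<phi> g (Suc v) s) + (\<Sum>s<r. \<phi> g (Suc v) s)"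
      proof cases
        \<comment> \<open>The only condition that becomes stronger. The gap \<open>le\<close> covers
          it, as row \<open>0\<close> has at most \<open>b 0\<close> old entries.\<close>
        case 1
        thus ?thesis unfolding s1 s2 using le patterns_le[OF g, of "Suc (Suc 0)" 0] by simp
      next
        case 2
        thus ?thesis unfolding s1 s2 using old le by simp
      next
        case 3
        thus ?thesis unfolding s1 s2 using old by simp
      qed
    qed
    show ?thesis using h weight row_dominant_imp_dominant[OF h anti row] by (simp add: LR_patterns_def)
  qed
  moreover have "inj_on \<phi> (LR_patterns a b)"
  proof (intro inj_onI ext)
    fix g h i r assume "\<phi> g = \<phi> h"
    hence "\<phi> g i r = \<phi> h i r" by simp
    thus "g i r = h i r" by (simp add: \<phi>_def)
  qed
  ultimately show ?thesis unfolding LR_embeds_def by blast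
qed

lemma tail_size_Suc_le:
  assumes g: "g \<in> patterns b" shows "tail_size J g (Suc i) \<le> tail_size J g i + weight g i"
proof -
  have "tail_size J g (Suc i) + tail_size 0 g i \<le> tail_size J g i + tail_size 0 g (Suc i)"
    unfolding tail_size_eq[OF g order_refl[of "Suc i"]] tail_size_eq[OF g le_SucI[OF order_refl[of i]]] sum.distrib[symmetric]
  proof (intro sum_mono)
    fix r show "g (Suc i) r - J + (g i r - 0) \<le> g i r - J + (g (Suc i) r - 0)"
      using patternsD(3)[OF g, of i r] by simp
  qed
  thus ?thesis using weight_add[OF g, of i] by simp
qed

lemma sum_lessThan_add: "(\<Sum>r<m + n. f r) = (\<Sum>r<m. f r) + (\<Sum>t<n. f (m + t :: nat) :: nat)"
  by (induction n) simp_all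

text \<open>
  No entry lies in \<open>{L - j..<L}\<close>. Subtracting \<open>j\<close> from the entries \<open>\<ge> L\<close> frees the \<open>j\<close> largest row indices
  of the final shape \<open>nu\<close>, which become the entries of the new boxes at the bottom of the first column.
\<close>

lemma LR_embeds_first_column:
  assumes a: "shape a" and aL: "\<And>r. 0 < a r \<longleftrightarrow> r < L" and ac: "\<And>r. c \<le> r \<Longrightarrow> a r \<le> 1"
    and b: "shape b" and bM: "\<And>r. 0 < b r \<longleftrightarrow> r < M" and le: "c + M + j \<le> L" and "0 < j"
  shows "LR_embeds a b (\<lambda>r. if r < L - j then a r else 0) (\<lambda>r. if M \<le> r \<and> r < M + j then 1 else b r)"
proof -
  let ?a = "\<lambda>r. if r < L - j then a r else 0" and ?b = "\<lambda>r. if M \<le> r \<and> r < M + j then 1 else b r"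
  define K where "K = L - j"
  have L: "L = K + j" using le by (simp add: K_def)
  define len where "len g = (LEAST n. a n + weight g n = 0)" for g
  \<comment> \<open>In the old rows, levels after \<open>K\<close> are read off \<open>j\<close>
    levels later. Each new row \<open>r\<close> is one box with entry
    \<open>len g - j + (r - M)\<close>, where \<open>len g\<close> is the length of the final
    partition.\<close>
  define \<phi> where "\<phi> g i r = (if r < M then g (if i \<le> K then i else i + j) r
    else if r < M + j \<and> len g - j + (r - M) < i then 1 else 0)" for g :: "nat \<Rightarrow> nat \<Rightarrow> nat" and i r :: nat
  have b0: "b r = 0" if "M \<le> r" for r using that bM[of r] by simp
  have a0: "a r = 0" if "L \<le> r" for r using that aL[of r] by simp
  \<comment> \<open>The values of \<open>a\<close> from \<open>c\<close> to \<open>L - 1\<close> are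
    all \<open>1\<close>, so by \<open>dominant_const_run\<close> an entry \<open>v\<close> in this
    range needs a row from \<open>v - c\<close> on. For \<open>v \<ge> K\<close> such a row lies
    below the diagram of \<open>b\<close>.\<close>
  have const: "g i = g K" if g: "g \<in> LR_patterns a b" and i: "K \<le> i" "i \<le> L" for g i
  proof
    fix r
    from g have g': "g \<in> patterns b" "dominant a g" by (auto simp: LR_patterns_def)
    have run: "a v \<le> a (Suc v)" if "c \<le> v" "Suc v < L" for v
      using ac[OF that(1)] aL[of "Suc v"] that(2) by linarith
    have "K + n \<le> L \<Longrightarrow> g (K + n) r = g K r" for n
    proof (induction n)
      case (Suc n)
      show ?case
      proof (cases "r < M")
        case True
        have "g (Suc (c + (K + n - c))) r = g (c + (K + n - c)) r"
          by (rule dominant_const_run[OF g' run]) (use Suc.prems True le in \<open>auto simp: L\<close>)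
        thus ?thesis using Suc le by (simp add: L)
      next
        case False
        thus ?thesis using patterns_le[OF g'(1), of _ r] b0[of r] by (metis le_zero_eq not_le)
      qed
    qed simp
    from this[of "i - K"] i show "g i r = g K r" by simp
  qed
  have "\<phi> g \<in> LR_patterns ?a ?b \<and> (\<forall>i. ?a i + weight (\<phi> g) i = a i + weight g i)" if gLR: "g \<in> LR_patterns a b" for g
  proof -
    from gLR have g: "g \<in> patterns b" and dominant: "dominant a g" by (auto simp: LR_patterns_def)
    let ?h = "\<phi> g"
    define nu where "nu i = a i + weight g i" for i
    have "shape nu" unfolding nu_def by (rule dominant_shape[OF dominant g a b])
    hence nu: "antimono nu" and ex0: "\<exists>n. nu n = 0" by (auto simp: shape_def)
    define l where "l = len g"
    have l_Least: "l = (LEAST n. nu n = 0)" by (simp add: l_def len_def nu_def)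
    have nu_l: "nu l = 0" unfolding l_Least by (rule LeastI_ex[OF ex0])
    have nu_pos: "0 < nu i" if "i < l" for i using not_less_Least[of i "\<lambda>n. nu n = 0"] that l_Least by auto
    have nu_0: "nu i = 0" if "l \<le> i" for i using antimonoD[OF nu that] nu_l by simp
    have Ll: "L \<le> l"
    proof (rule ccontr)
      assume "\<not> L \<le> l"
      thus False using aL[of l] nu_l by (simp add: nu_def)
    qed
    define m where "m = l - j"
    have m: "l = m + j" "K \<le> m" using Ll by (auto simp: m_def L)
    have gl: "g i = b" if "l \<le> i" for i
      using bounded_patterns_iff_weight[OF g, of l] nu_0 that by (auto simp: bounded_patterns_def nu_def)
    have gK: "g (K + j) = g K" using const[OF gLR, of "K + j"] by (simp add: L)
    \<comment> \<open>Since \<open>K\<close> does not occur as an entry,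
      \<open>nu K = a K \<le> 1\<close>; so \<open>nu\<close> consists of ones from \<open>K\<close>
      to \<open>l - 1\<close>.\<close>
    have wtK: "weight g K = 0"
      using const[OF gLR, of "Suc K"] assms(7) weight_add[OF g, of K] tail_size_eq[OF g, of K "Suc K" 0] tail_size_eq[OF g, of "Suc K" "Suc K" 0]
      by (simp add: L)
    have "a K \<le> 1" by (rule ac) (use le in \<open>simp add: L\<close>)
    hence nu_le: "nu i \<le> 1" if "K \<le> i" for i
      using antimonoD[OF nu that] wtK by (simp add: nu_def)
    hence nu_1: "nu i = 1" if "K \<le> i" "i < l" for i
      using that nu_pos[of i] nu_le[of i] by linarith
    define u where "u i = (if i \<le> K then i else i + j)" for i
    have gu: "g (u i) = g (i + j)" if "K \<le> i" for i using that gK by (auto simp: u_def)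
    have h_old: "?h i r = g (u i) r" if "r < M" for i r using that by (simp add: \<phi>_def u_def)
    have h_new: "?h i r = of_bool (r < M + j \<and> m + (r - M) < i)" if "M \<le> r" for i r
      using that by (simp add: \<phi>_def m_def l_def)
    have h: "?h \<in> patterns ?b"
      unfolding patterns_def
    proof (intro CollectI conjI allI)
      fix r show "?h 0 r = 0" using patternsD(1)[OF g] by (simp add: \<phi>_def)
    next
      fix i r
      show "?h i r \<le> ?h (Suc i) r"
      proof (cases "r < M")
        case True
        have "g (u i) r \<le> g (u (Suc i)) r" by (rule patterns_mono[OF g]) (simp add: u_def)
        thus ?thesis using True by (simp add: h_old)
      qed (simp add: h_new)
      consider "Suc r < M" | "Suc r = M" | "M \<le> r" by linarith
      thus "?h (Suc i) (Suc r) \<le> ?h i r"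
      proof cases
        case 1
        have "g (u (Suc i)) (Suc r) \<le> g (u i) r"
        proof (cases "Suc i \<le> K")
          case True
          thus ?thesis using patternsD(2)[OF g] by (simp add: u_def)
        next
          case False
          thus ?thesis using patternsD(2)[OF g, of "i + j" r] by (simp add: gu)
        qed
        thus ?thesis using 1 by (simp add: h_old)
      next
        \<comment> \<open>The topmost new box has entry \<open>m\<close> and lies below the last old
          row, which is complete from level \<open>m\<close> on.\<close>
        case 2
        show ?thesis
        proof (cases "m \<le> i")
          case True
          hence "?h i r = b r" using 2 m by (simp add: h_old gu gl)
          moreover have "0 < b r" using bM[of r] 2 by simp
          ultimately show ?thesis using 2 by (simp add: h_new)
        next
          case False
          thus ?thesis using 2 by (simp add: h_new)
        qed
      next
        case 3
        thus ?thesis by (simp add: h_new Suc_diff_le)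
      qed
    next
      have "?h i r = ?b r" if i: "l < i" for i r
      proof (cases "r < M")
        case True
        thus ?thesis using i m gl[of "i + j"] by (simp add: h_old gu)
      next
        case False
        thus ?thesis using i m b0[of r] by (cases "r < M + j") (auto simp: h_new)
      qed
      thus "\<exists>N. \<forall>i\<ge>N. ?h i = ?b" by (intro exI[of _ "Suc l"]) (auto simp: fun_eq_iff)
    qed
    \<comment> \<open>The new boxes lie in column \<open>0\<close> and count for
      \<open>J = 0\<close> only; \<open>min j (i - m)\<close> of them have entries below
      \<open>i\<close>.\<close>
    have tail: "tail_size J ?h i = tail_size J g (u i) + (if J = 0 then min j (i - m) else 0)" for J i
    proof -
      define R where "R = M + (j + u i)"
      have "tail_size J ?h i = (\<Sum>r<R. ?h i r - J)" by (rule tail_size_eq[OF h]) (simp add: R_def u_def)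
      also have "\<dots> = (\<Sum>r<M. ?h i r - J) + (\<Sum>t<j + u i. ?h i (M + t) - J)"
        unfolding R_def by (rule sum_lessThan_add)
      also have "(\<Sum>r<M. ?h i r - J) = (\<Sum>r<M. g (u i) r - J)" by (simp add: h_old)
      also have "\<dots> = (\<Sum>r<R. g (u i) r - J)"
      proof (rule sum.mono_neutral_left)
        show "\<forall>r\<in>{..<R} - {..<M}. g (u i) r - J = 0"
          using patterns_le[OF g, of "u i"] b0 by (metis DiffD2 diff_0_eq_0 le_zero_eq lessThan_iff not_le)
      qed (auto simp: R_def)
      also have "\<dots> = tail_size J g (u i)" by (rule tail_size_eq[OF g, symmetric]) (simp add: R_def)
      also have "(\<Sum>t<j + u i. ?h i (M + t) - J) = (if J = 0 then min j (i - m) else 0)"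
      proof (cases "J = 0")
        case True
        have "(\<Sum>t<j + u i. ?h i (M + t) - J) = card {t \<in> {..<j + u i}. t < j \<and> m + t < i}"
          using True by (simp add: h_new of_bool_def sum.If_cases Int_def)
        also have "{t \<in> {..<j + u i}. t < j \<and> m + t < i} = {..<min j (i - m)}" by auto
        finally show ?thesis using True by simp
      qed (simp add: h_new)
      finally show ?thesis .
    qed
    have weight_shift: "weight ?h v = weight g (v + j) + of_bool (m \<le> v \<and> v < m + j)" if v: "K \<le> v" for v
    proof -
      have "tail_size 0 g (u v) = tail_size 0 g (v + j)"
        using gu[OF v] tail_size_eq[OF g, of "u v" "v + j" 0] tail_size_eq[OF g, of "v + j" "v + j" 0] by (simp add: u_def)
      moreover have "u (Suc v) = Suc (v + j)" using v by (simp add: u_def)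
      ultimately show ?thesis
        using weight_add[OF h, of v] weight_add[OF g, of "v + j"] tail[of 0 v] tail[of 0 "Suc v"]
        by (auto simp: min_def split: if_splits)
    qed
    have weight: "?a i + weight ?h i = nu i" for i
    proof (cases "i < K")
      case True
      hence "weight ?h i = weight g i"
        using weight_add[OF h, of i] weight_add[OF g, of i] tail[of 0 i] tail[of 0 "Suc i"] m by (simp add: u_def)
      thus ?thesis using True by (simp add: nu_def K_def)
    next
      case False
      hence i: "K \<le> i" by simp
      have "weight g (i + j) = nu (i + j)" using a0[of "i + j"] i by (simp add: nu_def L)
      \<comment> \<open>Shifting the final run of ones by \<open>j\<close> leaves ones up to
        \<open>m - 1\<close>; the new boxes supply \<open>m\<close> to \<open>l - 1\<close>.\<close>
      moreover consider "i < m" | "m \<le> i" "i < l" | "l \<le> i" by linarith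
      hence "nu (i + j) + of_bool (m \<le> i \<and> i < m + j) = nu i"
        by cases (use nu_1[of i] nu_1[of "i + j"] nu_0[of i] nu_0[of "i + j"] i m in auto)
      ultimately show ?thesis using i weight_shift[OF i] by (simp add: K_def)
    qed
    have "dominant ?a ?h"
      unfolding dominant_def
    proof (intro allI)
      fix J v
      show "?a (Suc v) + tail_size J ?h (Suc (Suc v)) + tail_size J ?h v \<le> ?a v + 2 * tail_size J ?h (Suc v)"
      proof (cases "J = 0")
        case True
        have "nu (Suc v) \<le> nu v" using nu by (simp add: antimono_iff_le_Suc)
        thus ?thesis
          unfolding True using weight[of v] weight[of "Suc v"] weight_add[OF h, of v] weight_add[OF h, of "Suc v"] by linarith
      next
        case False
        hence tl: "tail_size J ?h i = tail_size J g (u i)" for i using tail[of J i] by simp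
        have tl_shift: "tail_size J ?h i = tail_size J g (i + j)" if "K \<le> i" for i
          using gu[OF that] tail_size_eq[OF g, of "u i" "i + j" J] tail_size_eq[OF g, of "i + j" "i + j" J] by (simp add: tl u_def)
        have dominant': "a (Suc v) + tail_size J g (Suc (Suc v)) + tail_size J g v \<le> a v + 2 * tail_size J g (Suc v)" for v
          using dominant unfolding dominant_def by blast
        consider "Suc v < K" | "Suc v = K" | "K \<le> v" by linarith
        thus ?thesis
        proof cases
          case 1
          thus ?thesis using dominant'[of v] by (simp add: tl u_def K_def)
        next
          \<comment> \<open>At the seam no old condition applies directly. The entry
            \<open>L\<close> occurs at most once because \<open>nu L \<le> 1\<close>, and
            \<open>0 < a v\<close> pays for it.\<close>
          case 2
          have "tail_size J ?h (Suc (Suc v)) = tail_size J g (Suc L)"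
            using tl_shift[of "Suc (Suc v)"] 2 by (simp add: L)
          also have "\<dots> \<le> tail_size J g L + weight g L" by (rule tail_size_Suc_le[OF g])
          also have "weight g L \<le> 1" using nu_le[of L] by (simp add: nu_def L)
          also have "tail_size J g L = tail_size J ?h (Suc v)" using tl_shift[of "Suc v"] 2 by (simp add: L)
          finally have "tail_size J ?h (Suc (Suc v)) \<le> tail_size J ?h (Suc v) + 1" by simp
          moreover have "tail_size J ?h v \<le> tail_size J ?h (Suc v)" by (rule tail_size_mono[OF h]) simp
          moreover have "0 < a v" using aL[of v] 2 by (simp add: L)
          ultimately show ?thesis using 2 by (simp add: K_def)
        next
          case 3
          thus ?thesis using dominant'[of "v + j"] tl_shift[of v] tl_shift[of "Suc v"] tl_shift[of "Suc (Suc v)"]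
            a0[of "v + j"] a0[of "Suc (v + j)"] by (simp add: L)
        qed
      qed
    qed
    thus ?thesis using h weight by (simp add: LR_patterns_def nu_def)
  qed
  \<comment> \<open>The old rows determine \<open>g\<close>, since the skipped levels are constant;
    \<open>len g\<close> need not be recovered.\<close>
  moreover have "inj_on \<phi> (LR_patterns a b)"
  proof (intro inj_onI ext)
    fix g h i r assume g: "g \<in> LR_patterns a b" and h: "h \<in> LR_patterns a b" and eq: "\<phi> g = \<phi> h"
    have eq': "g (if i \<le> K then i else i + j) r = h (if i \<le> K then i else i + j) r" if "r < M" for i
      using fun_cong[OF fun_cong[OF eq, of i], of r] that by (simp add: \<phi>_def)
    show "g i r = h i r"
    proof (cases "r < M")
      case True
      consider "i \<le> K" | "K \<le> i" "i \<le> L" | "L < i" by linarith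
      thus ?thesis
      proof cases
        case 1
        thus ?thesis using eq'[OF True, of i] by simp
      next
        case 2
        thus ?thesis using eq'[OF True, of K] const[OF g 2] const[OF h 2] by simp
      next
        case 3
        hence "\<not> i - j \<le> K" "i - j + j = i" by (auto simp: L)
        thus ?thesis using eq'[OF True, of "i - j"] by simp
      qed
    next
      case False
      thus ?thesis using patterns_le[of g b i r] patterns_le[of h b i r] g h b0[of r] by (simp add: LR_patterns_def)
    qed
  qed
  ultimately show ?thesis unfolding LR_embeds_def by blast
qed

section \<open>The shapes in the sequence\<close>

lemma union_partition_ones:
  assumes "is_partition lam" shows "union_partition lam (replicate p 1) = lam @ replicate p 1"
proof -
  have "sorted_wrt (\<ge>) (lam @ replicate p (1 :: nat))"
    using assms is_partition_ones[of p] by (auto simp: is_partition_def sorted_wrt_append Suc_le_eq intro: gr0I)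
  hence "sorted (rev (lam @ replicate p 1))" by (simp only: sorted_wrt_rev)
  hence "sort (lam @ replicate p 1) = rev (lam @ replicate p 1)" by (intro properties_for_sort) auto
  thus ?thesis by (simp add: union_partition_def)
qed

lemma row_length_add_first: "row_length (add_first lam q) r = row_length lam r + (if r = 0 then q else 0)"
  by (cases lam; cases r) (auto simp: row_length_def)

lemma row_length_extension:
  assumes "is_partition lam"
  shows "row_length (add_first (union_partition lam (replicate p 1)) q) r =
    (if r < length lam then lam ! r else if r < length lam + p then 1 else 0) + (if r = 0 then q else 0)"
  unfolding row_length_add_first union_partition_ones[OF assms] by (simp add: row_length_def nth_append)

lemma nth_le_1_if_second_column_le:
  assumes lam: "is_partition lam" and "part (transpose_partition lam) 2 \<le> r" "r < length lam"
  shows "lam ! r \<le> 1"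
proof (rule ccontr)
  assume "\<not> lam ! r \<le> 1"
  hence r: "2 \<le> lam ! r" by simp
  have "2 \<le> lam ! i" if "i \<le> r" for i
  proof (cases "i = r")
    case False
    hence "lam ! r \<le> lam ! i"
      using lam that assms(3) by (simp add: is_partition_def sorted_wrt_iff_nth_less)
    thus ?thesis using r by simp
  qed (simp add: r)
  hence "Suc ` {..r} \<subseteq> {s. 1 \<le> s \<and> 2 \<le> part lam s}"
    using assms(3) by (auto simp: Defs.part_def)
  moreover have "finite {s. 1 \<le> s \<and> 2 \<le> part lam s}"
    by (rule finite_subset[of _ "{..length lam}"]) (auto simp: Defs.part_def split: if_splits)
  ultimately have "card (Suc ` {..r}) \<le> card {s. 1 \<le> s \<and> 2 \<le> part lam s}" by (rule card_mono[rotated])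
  also have "\<dots> = part (transpose_partition lam) 2"
    by (rule part_transpose_partition[OF lam, symmetric]) simp
  finally show False using assms(2) by (simp add: card_image)
qed

theorem theoremA:
  fixes lam :: "nat list" and j k :: nat
  assumes "is_partition lam"
    and "k = 0 \<or> k \<ge> part lam 2"
    and "j = 0 \<or> j \<ge> part (transpose_partition lam) 2"
  shows "strongly_schur_log_concave
    (\<lambda>m. schur (add_first (union_partition lam (replicate (m * j) 1)) (m * k)))"
  unfolding strongly_schur_log_concave_def
proof (intro allI impI)
  fix n i :: nat assume n: "1 \<le> n"
  let ?P = "\<lambda>p q. add_first (union_partition lam (replicate p 1)) q"
  let ?l = "length lam"
  \<comment> \<open>The multiples \<open>(x + 1, y)\<close> are to be balanced into
    \<open>(x, y + 1)\<close>.\<close>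
  define x y where "x = n + i" and "y = n - 1"
  have xy: "n = Suc y" "y < x" using n by (auto simp: x_def y_def)
  note rl = row_length_extension[OF assms(1), unfolded One_nat_def]
  have part: "is_partition (?P p q)" for p q
    by (intro is_partition_add_first is_partition_union_partition is_partition_ones assms(1))
  have lam_pos: "0 < lam ! r" if "r < ?l" for r
    using assms(1) that by (metis is_partition_def gr0I nth_mem)
  have column: "LR_embeds (row_length (?P (Suc x * j) (Suc x * k))) (row_length (?P (y * j) (y * k)))
    (row_length (?P (x * j) (Suc x * k))) (row_length (?P (n * j) (y * k)))"
  proof (cases "j = 0")
    case False
    let ?a = "row_length (?P (Suc x * j) (Suc x * k))" and ?b = "row_length (?P (y * j) (y * k))"
    let ?L = "?l + Suc x * j" and ?M = "?l + y * j"
    \<comment> \<open>The maximum with \<open>1\<close> excludes row \<open>0\<close>, which is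
      lengthened by a multiple of \<open>k\<close>.\<close>
    define c where "c = max 1 (part (transpose_partition lam) 2)"
    have "c \<le> j" using assms(3) False by (simp add: c_def)
    moreover have "Suc y * j \<le> x * j" using xy by (intro mult_le_mono1) simp
    ultimately have le: "c + ?M + j \<le> ?L" by simp
    have "LR_embeds ?a ?b (\<lambda>r. if r < ?L - j then ?a r else 0) (\<lambda>r. if ?M \<le> r \<and> r < ?M + j then 1 else ?b r)"
    proof (rule LR_embeds_first_column[OF shape_row_length[OF part] _ _ shape_row_length[OF part] _ le])
      show "0 < ?a r \<longleftrightarrow> r < ?L" for r using False lam_pos[of r] by (auto simp: rl)
      show "?a r \<le> 1" if "c \<le> r" for r
        using that[unfolded c_def] nth_le_1_if_second_column_le[OF assms(1), of r] by (auto simp: rl)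
      \<comment> \<open>If \<open>lam\<close> is empty, row \<open>0\<close> needs care: for
        \<open>y = 0\<close> nothing is added to it, and for \<open>y > 0\<close> there are appended
        ones.\<close>
      show "0 < ?b r \<longleftrightarrow> r < ?M" for r unfolding row_length_extension[OF assms(1)]
        using False lam_pos[of r] by (cases y) auto
    qed (use False in simp)
    moreover have "(\<lambda>r. if r < ?L - j then ?a r else 0) = row_length (?P (x * j) (Suc x * k))"
      using False xy by (auto simp: rl fun_eq_iff)
    moreover have "(\<lambda>r. if ?M \<le> r \<and> r < ?M + j then 1 else ?b r) = row_length (?P (n * j) (y * k))"
      unfolding fun_eq_iff row_length_extension[OF assms(1)] xy by (cases y) auto
    ultimately show ?thesis by simp
  qed (simp add: LR_embeds_refl)
  have row: "LR_embeds (row_length (?P (x * j) (Suc x * k))) (row_length (?P (n * j) (y * k)))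
    (row_length (?P (x * j) (x * k))) (row_length (?P (n * j) (n * k)))"
  proof (cases "k = 0")
    case False
    let ?a = "row_length (?P (x * j) (Suc x * k))" and ?b = "row_length (?P (n * j) (y * k))"
    have "antimono ?a" using shape_row_length[OF part] by (simp add: shape_def)
    moreover have "?a (Suc 0) + ?b 0 + k \<le> ?a 0"
    proof -
      \<comment> \<open>The second row is \<open>part lam 2\<close>, an appended \<open>1\<close> or
        empty.\<close>
      have "?a (Suc 0) \<le> k"
      proof -
        have "part lam 2 = (if 1 < length lam then lam ! 1 else 0)" by (auto simp: Defs.part_def)
        thus ?thesis using assms(2) False by (auto simp: rl split: if_splits)
      qed
      moreover have "?b 0 + (x - y) * k + k \<le> ?a 0"
      proof -
        have "(x - y) * k + y * k = x * k" using xy by (simp add: algebra_simps flip: add_mult_distrib)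
        \<comment> \<open>For empty \<open>lam\<close> an appended \<open>1\<close> may start the
          first row; if it does so in \<open>?b\<close>, it also does in \<open>?a\<close>.\<close>
        moreover have "n * j \<le> x * j" by (simp add: x_def)
        ultimately show ?thesis using False xy by (auto simp: rl)
      qed
      moreover have "1 \<le> x - y" using xy(2) by arith
      hence "k \<le> (x - y) * k" using mult_le_mono1[of 1 "x - y" k] by simp
      ultimately show ?thesis by linarith
    qed
    ultimately have "LR_embeds ?a ?b (?a(0 := ?a 0 - k)) (?b(0 := ?b 0 + k))"
      by (rule LR_embeds_first_row)
    moreover have "?a(0 := ?a 0 - k) = row_length (?P (x * j) (x * k))"
      unfolding fun_eq_iff fun_upd_apply row_length_extension[OF assms(1)] by simp
    moreover have "?b(0 := ?b 0 + k) = row_length (?P (n * j) (n * k))"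
      unfolding fun_eq_iff fun_upd_apply row_length_extension[OF assms(1)] by (simp add: xy)
    ultimately show ?thesis by simp
  qed (simp add: LR_embeds_refl)
  have "schur_positive (schur (?P (x * j) (x * k)) * schur (?P (n * j) (n * k))
    - schur (?P (Suc x * j) (Suc x * k)) * schur (?P (y * j) (y * k)))"
    by (intro schur_positive_if_LR_embeds part LR_embeds_trans[OF column row])
  thus "schur_positive (schur (?P ((n + i) * j) ((n + i) * k)) * schur (?P (n * j) (n * k))
    - schur (?P ((n + i + 1) * j) ((n + i + 1) * k)) * schur (?P ((n - 1) * j) ((n - 1) * k)))"
    by (simp add: x_def y_def)
qed

end
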